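(* Let $1<p<\infty$, let $\Omega\subset\mathbb{H}^n$ be open, $T>0$, $\Omega_T=(0,T)\times\Omega$. Suppose $u:\Omega_T\to\mathbb{R}$ is a lower semicontinuous function with the property that for every $(t^0,x^0)\in\Omega_T$ and every $\phi\in C_H^2(\Omega_T)$ satisfying $u(t^0,x^0)=\phi(t^0,x^0)$ and $u(t,x)>\phi(t,x)$ for $(t,x)\neq(t^0,x^0)$, the following holds: $$\begin{cases}\phi_t(t^0,x^0)\ge(p-2)\Delta_H^\infty\phi(t^0,x^0)+\Delta_H\phi(t^0,x^0) & \text{if }\nabla_0\phi(t^0,x^0)\ne0,\\[1mm] \phi_t(t^0,x^0)\ge0 & \text{if }\nabla_0\phi(t^0,x^0)=0\text{ and }(X^2\phi)^*(t^0,x^0)=0.\end{cases}$$ Then $u$ is a viscosity super-solution of $$u_t=|\nabla_0u|^{2-p}\Delta_H^pu=(p-2)\Delta_H^\infty u+\Delta_Hu .$$ The same result holds for viscosity sub-solutions: if $u:\Omega_T\to\mathbb{R}$ is upper semicontinuous and for every $(t^0,x^0)\in\Omega_T$ and $\phi\in C_H^2(\Omega_T)$ with $u(t^0,x^0)=\phi(t^0,x^0)$ and $u(t,x)<\phi(t,x)$ for $(t,x)\ne(t^0,x^0)$ one has $$\begin{cases}\phi_t(t^0,x^0)\le(p-2)\Delta_H^\infty\phi(t^0,x^0)+\Delta_H\phi(t^0,x^0) & \text{if }\nabla_0\phi(t^0,x^0)\ne0,\\[1mm] \phi_t(t^0,x^0)\le0 & \text{if }\nabla_0\phi(t^0,x^0)=0\text{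 and }(X^2\phi)^*(t^0,x^0)=0,\end{cases}$$ then $u$ is a viscosity sub-solution of $u_t=(p-2)\Delta_H^\infty u+\Delta_Hu$.
   Context: $n\ge1$ is an integer. The Heisenberg group $\mathbb{H}^n$ is $\mathbb{R}^{2n+1}$ with points $x=(x_1,\dots,x_{2n},x_{2n+1})$ and group law $$x^0\circ x=\Big(x_1+x_1^0,\dots,x_{2n}+x_{2n}^0,\;x_{2n+1}+x_{2n+1}^0+2\sum_{i=1}^n(x_ix_{n+i}^0-x_i^0x_{n+i})\Big).$$ For $i=1,\dots,n$ let $X_i=\partial_{x_i}+2x_{n+i}\partial_{x_{2n+1}}$, $X_{n+i}=\partial_{x_{n+i}}-2x_i\partial_{x_{2n+1}}$ (acting in the space variable). Define $\nabla_0u=(X_1u,\dots,X_{2n}u)$, $(X^2u)^*=\big(\tfrac12(X_iX_ju+X_jX_iu)\big)_{i,j=1}^{2n}$, $\Delta_Hu=\sum_{i=1}^{2n}X_iX_iu$, $\Delta_H^pu=\sum_{i=1}^{2n}X_i(|\nabla_0u|^{p-2}X_iu)$, and $\Delta_H^\infty u=|\nabla_0u|^{-2}\langle(X^2u)^*\nabla_0u,\nabla_0u\rangle$. For a symmetric matrix $A$, $\lambda_{\min}(A)$ is its smallest eigenvalue. $C_H^2(\Omega_T)$ is the class of functions $\phi(t,x)$ on $\Omega_T$ whose horizontal derivatives (compositions of the $X_i$) of order at most 2 exist and are continuous, and for which $\phi_t$ exists and is continuous. Viscosity solutions of $u_t=(p-2)\Delta_H^\infty u+\Delta_Hu$: a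 lower semicontinuous $u:\Omega_T\to\mathbb{R}\cup\{+\infty\}$, not identically $+\infty$ in any component of $\Omega_T$, is a viscosity super-solution if for every $(t^0,x^0)\in\Omega_T$ and every $\phi\in C_H^2(\Omega_T)$ with $u(t^0,x^0)=\phi(t^0,x^0)$ and $u(t,x)>\phi(t,x)$ for $(t,x)\ne(t^0,x^0)$, one has at $(t^0,x^0)$: $\phi_t\ge(p-2)\Delta_H^\infty\phi+\Delta_H\phi$ if $\nabla_0\phi(t^0,x^0)\neq0$, and $\phi_t\ge\lambda_{\min}\big((p-2)(X^2\phi)^*\big)+\Delta_H\phi$ if $\nabla_0\phi(t^0,x^0)=0$. A function $u$ is a viscosity sub-solution if $-u$ is a viscosity super-solution. *)

theory Defs
  imports "HOL-Analysis.Analysis"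
begin

section \<open>The Heisenberg group and its horizontal vector fields\<close>

text \<open>
  The group of dimension \<open>2n + 1\<close>, with \<open>n = CARD('n)\<close>. A point is a pair \<open>(x', x\<^sub>2\<^sub>n\<^sub>+\<^sub>1)\<close>; the
  \<open>2n\<close> horizontal coordinates are indexed by the sum type \<open>'n + 'n\<close>, where \<open>Inl i\<close> stands for the
  index \<open>i\<close> and \<open>Inr i\<close> for the index \<open>n + i\<close>.
\<close>

type_synonym 'n heis = "(real ^ ('n + 'n)) \<times> real"

definition heis_mult :: "'n::finite heis \<Rightarrow> 'n heis \<Rightarrow> 'n heis" where
  "heis_mult y x =
     (fst x + fst y,
      snd x + snd y
        + 2 * (\<Sum>i\<in>UNIV. fst x $ Inl i * fst y $ Inr i - fst y $ Inl i * fst x $ Inr i))"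

fun horiz_field :: "'n::finite + 'n \<Rightarrow> 'n heis \<Rightarrow> 'n heis" where
  "horiz_field (Inl i) x = (axis (Inl i) 1, 2 * fst x $ Inr i)"
| "horiz_field (Inr i) x = (axis (Inr i) 1, - 2 * fst x $ Inl i)"

text \<open>
  The integral curve of \<open>X\<^sub>k\<close> through \<open>x\<close> is the straight line \<open>s \<mapsto> x + s X\<^sub>k(x)\<close>, which is also the
  right translation of \<open>x\<close> by \<open>s e\<^sub>k\<close>. This is left invariance.
\<close>

lemma heis_mult_axis:
  "heis_mult x (axis k s, 0) = x + s *\<^sub>R horiz_field k x"
proof (cases k)
  case (Inl i)
  have "(\<Sum>j\<in>UNIV. (axis (Inl i) s :: real ^ ('a + 'a)) $ Inl j * fst x $ Inr j
           - fst x $ Inl j * (axis (Inl i) s :: real ^ ('a + 'a)) $ Inr j)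
        = (\<Sum>j\<in>UNIV. if j = i then s * fst x $ Inr j else 0)"
    by (rule sum.cong) (auto simp: axis_def)
  then show ?thesis
    using Inl by (cases x) (auto simp: heis_mult_def vec_eq_iff axis_def)
next
  case (Inr i)
  have "(\<Sum>j\<in>UNIV. (axis (Inr i) s :: real ^ ('a + 'a)) $ Inl j * fst x $ Inr j
           - fst x $ Inl j * (axis (Inr i) s :: real ^ ('a + 'a)) $ Inr j)
        = (\<Sum>j\<in>UNIV. if j = i then - (fst x $ Inl j * s) else 0)"
    by (rule sum.cong) (auto simp: axis_def)
  then show ?thesis
    using Inr by (cases x) (auto simp: heis_mult_def vec_eq_iff axis_def)
qed

section \<open>Horizontal calculus for functions of time and space\<close>

text \<open>
  \<open>X\<^sub>k\<close> acts as the derivative along its own integral curves, so that \<open>X\<^sub>k \<phi>\<close> may exist although the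
  Euclidean partial derivatives of \<open>\<phi>\<close> do not. Where \<open>\<phi>\<close> is differentiable, this is
  the usual first-order operator \<open>\<partial>\<^sub>k \<plusminus> 2x \<partial>\<^sub>2\<^sub>n\<^sub>+\<^sub>1\<close>, see \<open>horiz_deriv_eq\<close>.
\<close>

definition horiz_differentiable ::
    "'n::finite + 'n \<Rightarrow> (real \<times> 'n heis \<Rightarrow> real) \<Rightarrow> real \<times> 'n heis \<Rightarrow> bool" where
  "horiz_differentiable k \<phi> z \<longleftrightarrow>
     (\<lambda>s. \<phi> (fst z, snd z + s *\<^sub>R horiz_field k (snd z))) differentiable (at 0)"

definition horiz_deriv ::
    "'n::finite + 'n \<Rightarrow> (real \<times> 'n heis \<Rightarrow> real) \<Rightarrow> real \<times> 'n heis \<Rightarrow> real" where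
  "horiz_deriv k \<phi> z = deriv (\<lambda>s. \<phi> (fst z, snd z + s *\<^sub>R horiz_field k (snd z))) 0"

definition time_differentiable :: "(real \<times> 'n::finite heis \<Rightarrow> real) \<Rightarrow> real \<times> 'n heis \<Rightarrow> bool" where
  "time_differentiable \<phi> z \<longleftrightarrow> (\<lambda>t. \<phi> (t, snd z)) differentiable (at (fst z))"

definition time_deriv :: "(real \<times> 'n::finite heis \<Rightarrow> real) \<Rightarrow> real \<times> 'n heis \<Rightarrow> real" where
  "time_deriv \<phi> z = deriv (\<lambda>t. \<phi> (t, snd z)) (fst z)"

lemma horiz_deriv_eq:
  assumes "(\<phi> has_derivative D) (at z)"
  shows "horiz_deriv k \<phi> z = D (0, horiz_field k (snd z))"
proof -
  let ?c = "\<lambda>s. (fst z, snd z + s *\<^sub>R horiz_field k (snd z))"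
  have "(?c has_derivative (\<lambda>s. (0, s *\<^sub>R horiz_field k (snd z)))) (at 0)"
    by (auto intro!: derivative_eq_intros)
  moreover have "(\<phi> has_derivative D) (at (?c 0))"
    using assms by simp
  ultimately have "((\<lambda>s. \<phi> (?c s)) has_derivative (\<lambda>s. D (0, s *\<^sub>R horiz_field k (snd z)))) (at 0)"
    by (rule has_derivative_compose)
  moreover have "D (0, s *\<^sub>R horiz_field k (snd z)) = s * D (0, horiz_field k (snd z))" for s
    using linear_scale[OF has_derivative_linear[OF assms], of s "(0, horiz_field k (snd z))"]
    by simp
  ultimately have "((\<lambda>s. \<phi> (?c s)) has_field_derivative D (0, horiz_field k (snd z))) (at 0)"
    by (simp add: has_field_derivative_def mult_commute_abs)
  then show ?thesis
    unfolding horiz_deriv_def by (rule DERIV_imp_deriv)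
qed

definition C2H :: "(real \<times> 'n::finite heis) set \<Rightarrow> (real \<times> 'n heis \<Rightarrow> real) \<Rightarrow> bool" where
  "C2H Q \<phi> \<longleftrightarrow>
     continuous_on Q \<phi> \<and>
     (\<forall>i. (\<forall>z\<in>Q. horiz_differentiable i \<phi> z) \<and> continuous_on Q (horiz_deriv i \<phi>)) \<and>
     (\<forall>i j. (\<forall>z\<in>Q. horiz_differentiable i (horiz_deriv j \<phi>) z) \<and>
            continuous_on Q (horiz_deriv i (horiz_deriv j \<phi>))) \<and>
     (\<forall>z\<in>Q. time_differentiable \<phi> z) \<and> continuous_on Q (time_deriv \<phi>)"

definition horiz_grad ::
    "(real \<times> 'n::finite heis \<Rightarrow> real) \<Rightarrow> real \<times> 'n heis \<Rightarrow> real ^ ('n + 'n)" where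
  "horiz_grad \<phi> z = (\<chi> i. horiz_deriv i \<phi> z)"

definition sym_horiz_hess ::
    "(real \<times> 'n::finite heis \<Rightarrow> real) \<Rightarrow> real \<times> 'n heis \<Rightarrow> real ^ ('n + 'n) ^ ('n + 'n)" where
  "sym_horiz_hess \<phi> z =
     (\<chi> i j. (horiz_deriv i (horiz_deriv j \<phi>) z + horiz_deriv j (horiz_deriv i \<phi>) z) / 2)"

definition horiz_laplacian :: "(real \<times> 'n::finite heis \<Rightarrow> real) \<Rightarrow> real \<times> 'n heis \<Rightarrow> real" where
  "horiz_laplacian \<phi> z = (\<Sum>i\<in>UNIV. horiz_deriv i (horiz_deriv i \<phi>) z)"

definition horiz_inf_laplacian :: "(real \<times> 'n::finite heis \<Rightarrow> real) \<Rightarrow> real \<times> 'n heis \<Rightarrow> real" where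
  "horiz_inf_laplacian \<phi> z =
     ((sym_horiz_hess \<phi> z *v horiz_grad \<phi> z) \<bullet> horiz_grad \<phi> z) / (norm (horiz_grad \<phi> z))\<^sup>2"

text \<open>Meaningful for symmetric matrices, which have at least one real eigenvalue.\<close>

definition lambda_min :: "real ^ 'm ^ 'm::finite \<Rightarrow> real" where
  "lambda_min A = (LEAST c. \<exists>v. v \<noteq> 0 \<and> A *v v = c *\<^sub>R v)"

section \<open>Viscosity solutions\<close>

definition lsc_on :: "'a::topological_space set \<Rightarrow> ('a \<Rightarrow> 'b::linorder) \<Rightarrow> bool" where
  "lsc_on Q u \<longleftrightarrow> (\<forall>z\<in>Q. \<forall>c. c < u z \<longrightarrow> (\<forall>\<^sub>F w in at z within Q. c < u w))"

definition usc_on :: "'a::topological_space set \<Rightarrow> ('a \<Rightarrow> 'b::linorder) \<Rightarrow> bool" where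
  "usc_on Q u \<longleftrightarrow> (\<forall>z\<in>Q. \<forall>c. u z < c \<longrightarrow> (\<forall>\<^sub>F w in at z within Q. u w < c))"

text \<open>
  Viscosity super- and sub-solutions of \<open>u\<^sub>t = (p - 2) \<Delta>\<^sub>H\<^sup>\<infinity> u + \<Delta>\<^sub>H u\<close> in \<open>Q\<close>. Only the values of \<open>u\<close>
  and \<open>\<phi>\<close> on \<open>Q\<close> matter when \<open>Q\<close> is open.
\<close>

definition visc_supersol ::
    "real \<Rightarrow> (real \<times> 'n::finite heis) set \<Rightarrow> (real \<times> 'n heis \<Rightarrow> ereal) \<Rightarrow> bool" where
  "visc_supersol p Q u \<longleftrightarrow>
     (\<forall>z\<in>Q. u z \<noteq> - \<infinity>) \<and>
     lsc_on Q u \<and>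
     (\<forall>C\<in>components Q. \<exists>z\<in>C. u z \<noteq> \<infinity>) \<and>
     (\<forall>z0\<in>Q. \<forall>\<phi>.
        C2H Q \<phi> \<and> u z0 = ereal (\<phi> z0) \<and> (\<forall>z\<in>Q. z \<noteq> z0 \<longrightarrow> u z > ereal (\<phi> z)) \<longrightarrow>
        (horiz_grad \<phi> z0 \<noteq> 0 \<longrightarrow>
           time_deriv \<phi> z0 \<ge> (p - 2) * horiz_inf_laplacian \<phi> z0 + horiz_laplacian \<phi> z0) \<and>
        (horiz_grad \<phi> z0 = 0 \<longrightarrow>
           time_deriv \<phi> z0
             \<ge> lambda_min ((p - 2) *\<^sub>R sym_horiz_hess \<phi> z0) + horiz_laplacian \<phi> z0))"

definition visc_subsol ::
    "real \<Rightarrow> (real \<times> 'n::finite heis) set \<Rightarrow> (real \<times> 'n heis \<Rightarrow> ereal) \<Rightarrow> bool" where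
  "visc_subsol p Q u \<longleftrightarrow> visc_supersol p Q (\<lambda>z. - u z)"

end

theory Submission
  imports Defs
begin

text \<open>
  Only test functions \<open>\<phi>\<close> with \<open>\<nabla>\<^sub>0 \<phi> = 0\<close> at the contact point \<open>z0 = (t0, x0)\<close> need an argument, and there
  the hypothesis on \<open>u\<close> says nothing unless the Hessian vanishes as well. The idea is to replace \<open>\<phi>\<close> by
  nearby test functions to which the hypothesis does apply. They come from doubling the space
  variable: for large \<open>j\<close> one minimizes
  \<open>u(t, x) - \<phi>(t, y) + j N(x\<^sup>-\<^sup>1 \<circ> y)\<close> with \<open>N(g) = |g'|\<^sup>4 + g\<^sub>v\<^sup>4\<close>,
  and the minimizers tend to \<open>(t0, x0, x0)\<close> while \<open>j N\<close> tends to zero.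

  The function \<open>\<phi>\<close> is twice differentiable along the horizontal fields, and these are left
  invariant. This turns a minimizer into test functions for \<open>u\<close>: if \<open>(t, x, y)\<close> is a minimizer and
  \<open>y = h \<circ> x\<close>, then the left translate \<open>\<phi>(t, h \<circ> x)\<close>, corrected by the penalty, touches
  \<open>u\<close> from below. Its second derivatives are those of \<open>\<phi>\<close> at \<open>y\<close> up to an error of size \<open>j N\<close>. If its
  gradient is not zero, the equation for it passes to the limit and gives a lower bound for \<open>\<phi>\<^sub>t\<close> by
  \<open>\<lambda>\<^sub>m\<^sub>i\<^sub>n((p - 2) (X\<^sup>2 \<phi>)\<^sup>*) + \<Delta>\<^sub>H \<phi>\<close>, since the smallest eigenvalue bounds the quadratic form in every direction.

  If its gradient is zero, the first-order conditions at the minimizer force \<open>x\<close> and \<open>y\<close> to have the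
  same horizontal coordinates. There the Hessian of \<open>N(x\<^sup>-\<^sup>1 \<circ> y)\<close> is antisymmetric, so freezing \<open>y\<close> gives
  a test function with zero gradient and zero symmetrized Hessian, whence \<open>\<phi>\<^sub>t \<ge> 0\<close> at \<open>(t, y)\<close>. Freezing
  \<open>x\<close> instead gives \<open>X\<^sub>k X\<^sub>k \<phi> \<le> 0\<close> for every \<open>k\<close>, and for \<open>p > 1\<close> this makes the right-hand side of the
  inequality nonpositive in the limit. Both cases are in \<open>touching_alternative\<close>, the limit is in
  \<open>critical_point_inequality\<close>. The local test functions are extended to the whole domain in
  \<open>weak_supersol_local_test\<close>, and the subsolution case follows by changing signs.
\<close>

section \<open>The symplectic form and the group law\<close>

text \<open>
  The group law is \<open>(a, v) \<circ> (b, w) = (a + b, v + w + \<omega>(a, b))\<close> with a symplectic form \<open>\<omega>\<close>, here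
  \<open>symp\<close>, and \<open>X\<^sub>k(x) = (e\<^sub>k, \<omega>(x', e\<^sub>k))\<close>. In this form every derivative along a horizontal line
  reduces to bilinearity, and the two facts on which the proof rests, \<open>\<omega>(a, a) = 0\<close> and the
  antisymmetry of \<open>\<omega>(e\<^sub>i, e\<^sub>k)\<close>, are the antisymmetry of one form.
\<close>

definition symp :: "real ^ ('n::finite + 'n) \<Rightarrow> real ^ ('n + 'n) \<Rightarrow> real" where
  "symp a b = 2 * (\<Sum>i\<in>UNIV. b $ Inl i * a $ Inr i - a $ Inl i * b $ Inr i)"

lemma bounded_bilinear_symp: "bounded_bilinear symp"
  unfolding bilinear_conv_bounded_bilinear[symmetric] bilinear_def symp_def
  by (intro conjI allI linearI)
     (simp_all add: algebra_simps sum.distrib sum_distrib_left sum_subtractf)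

lemmas symp_simps =
  bounded_bilinear.add_left[OF bounded_bilinear_symp]
  bounded_bilinear.add_right[OF bounded_bilinear_symp]
  bounded_bilinear.diff_left[OF bounded_bilinear_symp]
  bounded_bilinear.diff_right[OF bounded_bilinear_symp]
  bounded_bilinear.minus_left[OF bounded_bilinear_symp]
  bounded_bilinear.minus_right[OF bounded_bilinear_symp]
  bounded_bilinear.scaleR_left[OF bounded_bilinear_symp]
  bounded_bilinear.scaleR_right[OF bounded_bilinear_symp]
  bounded_bilinear.zero_left[OF bounded_bilinear_symp]
  bounded_bilinear.zero_right[OF bounded_bilinear_symp]

lemmas continuous_on_symp [continuous_intros] =
  bounded_bilinear.continuous_on[OF bounded_bilinear_symp]

lemma symp_commute: "symp b a = - symp a b"
  by (simp add: symp_def algebra_simps sum_subtractf)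

lemma symp_self [simp]: "symp a a = 0"
  by (simp add: symp_def algebra_simps)

lemma horiz_field_eq: "horiz_field k x = (axis k 1, symp (fst x) (axis k 1))"
proof (cases k)
  case (Inl i)
  have "(\<Sum>j\<in>UNIV. (axis (Inl i) 1 :: real ^ ('a + 'a)) $ Inl j * fst x $ Inr j
           - fst x $ Inl j * (axis (Inl i) 1 :: real ^ ('a + 'a)) $ Inr j)
        = (\<Sum>j\<in>UNIV. if j = i then fst x $ Inr j else 0)"
    by (rule sum.cong) (auto simp: axis_def)
  then show ?thesis using Inl by (simp add: symp_def)
next
  case (Inr i)
  have "(\<Sum>j\<in>UNIV. (axis (Inr i) 1 :: real ^ ('a + 'a)) $ Inl j * fst x $ Inr j
           - fst x $ Inl j * (axis (Inr i) 1 :: real ^ ('a + 'a)) $ Inr j)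
        = (\<Sum>j\<in>UNIV. if j = i then - fst x $ Inl j else 0)"
    by (rule sum.cong) (auto simp: axis_def)
  then show ?thesis using Inr by (simp add: symp_def)
qed

lemma abs_symp_axis_le: "\<bar>symp a (axis k 1)\<bar> \<le> 2 * norm a"
proof -
  have "snd (horiz_field k (a, 0)) = symp a (axis k 1)"
    by (simp add: horiz_field_eq)
  then have "\<exists>i. \<bar>symp a (axis k 1)\<bar> = 2 * \<bar>a $ i\<bar>"
    by (cases k) (force simp: abs_mult dest: sym)+
  then show ?thesis
    using component_le_norm_cart by (metis mult_left_mono zero_le_numeral)
qed

lemma sum_symp_axis: "(\<Sum>k\<in>UNIV. a $ k * symp b (axis k 1)) = symp b a"
proof -
  have "symp b a = symp b (\<Sum>k\<in>UNIV. a $ k *\<^sub>R axis k 1)"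
    by (simp add: basis_expansion scalar_mult_eq_scaleR[symmetric])
  also have "\<dots> = (\<Sum>k\<in>UNIV. a $ k * symp b (axis k 1))"
    by (simp add: bounded_bilinear.sum_right[OF bounded_bilinear_symp] symp_simps)
  finally show ?thesis by simp
qed

lemma heis_mult_eq: "heis_mult a b = (fst a + fst b, snd a + snd b + symp (fst a) (fst b))"
  by (simp add: heis_mult_def symp_def)

text \<open>
  Left invariance of \<open>X\<^sub>k\<close>: left translation maps its integral curves to integral curves with the
  same parameter.
\<close>

lemma heis_mult_horiz_field:
  "heis_mult h (x + s *\<^sub>R horiz_field k x) = heis_mult h x + s *\<^sub>R horiz_field k (heis_mult h x)"
  by (simp add: heis_mult_eq horiz_field_eq symp_simps algebra_simps)

lemma continuous_on_heis_mult [continuous_intros]: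
  "continuous_on A f \<Longrightarrow> continuous_on A g \<Longrightarrow> continuous_on A (\<lambda>z. heis_mult (f z) (g z))"
  unfolding heis_mult_eq by (intro continuous_intros)

section \<open>The smallest eigenvalue of a symmetric matrix\<close>

text \<open>
  The minimum \<open>c\<close> of the quadratic form on the unit sphere is attained, and a minimizer \<open>e\<close> is an
  eigenvector: \<open>\<langle>Av, v\<rangle> - c |v|\<^sup>2\<close> is nonnegative and vanishes at \<open>e\<close>, so its gradient
  \<open>2 (Ae - c e)\<close> vanishes too. Every eigenvalue is a value of the Rayleigh quotient, hence \<open>c\<close> is the
  least one.
\<close>

lemma lambda_min_le_Rayleigh:
  fixes A :: "real ^ 'm::finite ^ 'm"
  assumes sym: "transpose A = A"
  shows "lambda_min A * (v \<bullet> v) \<le> (A *v v) \<bullet> v"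
proof -
  let ?q = "\<lambda>v. (A *v v) \<bullet> v"
  have selfadj: "(A *v x) \<bullet> y = x \<bullet> (A *v y)" for x y
    using sym by (metis dot_lmul_matrix vector_transpose_matrix)
  have "continuous_on (sphere 0 1) ?q"
    by (intro continuous_intros linear_continuous_on linear_conv_bounded_linear[THEN iffD1] matrix_vector_mul_linear)
  moreover have "sphere 0 1 \<noteq> ({} :: (real ^ 'm) set)"
    by simp
  ultimately obtain e where e: "norm e = 1" and min: "\<And>w. norm w = 1 \<Longrightarrow> ?q e \<le> ?q w"
    using continuous_attains_inf[of "sphere (0 :: real ^ 'm) 1" ?q] by auto
  define c where "c = ?q e"
  have low: "c * (w \<bullet> w) \<le> ?q w" for w
  proof (cases "w = 0")
    case False
    have "c \<le> ?q ((1 / norm w) *\<^sub>R w)"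
      unfolding c_def using False by (intro min) simp
    also have "\<dots> = ?q w / (w \<bullet> w)"
      using False
      by (simp add: scaleR_matrix_vector_assoc[symmetric] matrix_vector_mult_scaleR
          power2_norm_eq_inner[symmetric] power2_eq_square)
    finally show ?thesis using False by (simp add: field_simps)
  qed simp
  have ee: "e \<bullet> e = 1"
    using e by (simp add: power2_norm_eq_inner[symmetric])
  have eig: "A *v e = c *\<^sub>R e"
  proof -
    define w where "w = A *v e - c *\<^sub>R e"
    define K where "K = ?q w - c * (w \<bullet> w)"
    have K: "K \<ge> 0" using low[of w] by (simp add: K_def)
    have *: "0 \<le> 2 * s * (w \<bullet> w) + s\<^sup>2 * K" for s
    proof -
      have "?q (e + s *\<^sub>R w) - c * ((e + s *\<^sub>R w) \<bullet> (e + s *\<^sub>R w))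
            = (?q e - c * (e \<bullet> e)) + 2 * s * (w \<bullet> (A *v e - c *\<^sub>R e)) + s\<^sup>2 * K"
        using selfadj[of w e]
        by (simp add: K_def matrix_vector_right_distrib matrix_vector_mult_scaleR inner_simps inner_commute
            power2_eq_square algebra_simps)
      then show ?thesis
        using low[of "e + s *\<^sub>R w"] ee unfolding w_def[symmetric] by (simp add: c_def[symmetric])
    qed
    \<comment> \<open>Otherwise a small step from \<open>e\<close> in the direction \<open>- w\<close> makes the form negative.\<close>
    have "w \<bullet> w \<le> 0"
    proof (rule ccontr)
      assume "\<not> w \<bullet> w \<le> 0"
      then have p: "w \<bullet> w > 0" by linarith
      define t where "t = (w \<bullet> w) / (K + 1)"
      have t: "0 < t" "w \<bullet> w = t * (K + 1)"
        using p K by (simp_all add: t_def)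
      have "0 \<le> 2 * (- t) * (w \<bullet> w) + (- t)\<^sup>2 * K"
        by (rule *)
      also have "\<dots> = - (t\<^sup>2 * (K + 2))"
        unfolding t(2) by (simp add: power2_eq_square algebra_simps)
      also have "\<dots> < 0"
        using K t(1) by simp
      finally show False by simp
    qed
    then have "w = 0" by (meson inner_ge_zero inner_eq_zero_iff antisym)
    then show ?thesis by (simp add: w_def)
  qed
  have "lambda_min A = c"
    unfolding lambda_min_def
  proof (rule Least_equality)
    show "\<exists>v. v \<noteq> 0 \<and> A *v v = c *\<^sub>R v"
      using eig e by (intro exI[of _ e]) auto
    show "c \<le> d" if "\<exists>v. v \<noteq> 0 \<and> A *v v = d *\<^sub>R v" for d
    proof -
      from that obtain v where v: "v \<noteq> 0" "A *v v = d *\<^sub>R v" by blast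
      then have "c * (v \<bullet> v) \<le> d * (v \<bullet> v)"
        using low[of v] by simp
      then show ?thesis using v by (simp add: mult_le_cancel_right)
    qed
  qed
  then show ?thesis using low by simp
qed

section \<open>Semicontinuous functions and penalization\<close>

text \<open>
  If no point were minimal, the relatively open sets \<open>{f > f (b k)}\<close>, where \<open>b k\<close> is a point with a
  smaller value than \<open>k\<close>, would cover \<open>K\<close>. In a finite subcover the smallest \<open>f (b k)\<close> is attained at a
  point that no member covers.
\<close>

lemma lsc_on_attains_inf:
  fixes f :: "'a::topological_space \<Rightarrow> real"
  assumes "compact K" "K \<noteq> {}" "lsc_on K f"
  shows "\<exists>k\<in>K. \<forall>l\<in>K. f k \<le> f l"
proof (rule ccontr)
  assume "\<not> ?thesis"
  then have "\<forall>k\<in>K. \<exists>l\<in>K. f l < f k"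
    by (auto simp: not_le)
  then obtain b where b: "\<And>k. k \<in> K \<Longrightarrow> b k \<in> K \<and> f (b k) < f k"
    by metis
  have "\<forall>k\<in>K. \<exists>U. open U \<and> k \<in> U \<and> (\<forall>w\<in>U \<inter> K. f (b k) < f w)"
  proof
    fix k assume k: "k \<in> K"
    have "\<forall>\<^sub>F w in at k within K. f (b k) < f w"
      using assms(3) k b unfolding lsc_on_def by blast
    then obtain U where "open U" "k \<in> U" "\<forall>w\<in>U. w \<noteq> k \<longrightarrow> w \<in> K \<longrightarrow> f (b k) < f w"
      unfolding eventually_at_topological by blast
    then show "\<exists>U. open U \<and> k \<in> U \<and> (\<forall>w\<in>U \<inter> K. f (b k) < f w)"
      using b[OF k] by (intro exI[of _ U]) (metis IntE)
  qed
  then obtain U where U: "\<And>k. k \<in> K \<Longrightarrow> open (U k) \<and> k \<in> U k \<and> (\<forall>w\<in>U k \<inter> K. f (b k) < f w)"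
    by metis
  have "K \<subseteq> (\<Union>k\<in>K. U k)" using U by blast
  then obtain C where C: "C \<subseteq> K" "finite C" "K \<subseteq> (\<Union>c\<in>C. U c)"
    using compactE_image[OF assms(1), of K U] U by metis
  then have "C \<noteq> {}" using assms(2) by auto
  then obtain c where c: "c \<in> C" "\<And>d. d \<in> C \<Longrightarrow> f (b c) \<le> f (b d)"
    using that arg_min_least[OF C(2), of _ "\<lambda>c. f (b c)"]
      arg_min_if_finite(1)[OF C(2), of "\<lambda>c. f (b c)"] by blast
  have "b c \<in> K" using b c C by blast
  then obtain d where "d \<in> C" "b c \<in> U d" using C by blast
  then have "f (b d) < f (b c)" using U \<open>b c \<in> K\<close> C by blast
  with c \<open>d \<in> C\<close> show False by fastforce
qed

lemma lsc_on_add_continuous: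
  fixes f g :: "'a::topological_space \<Rightarrow> real"
  assumes "lsc_on K f" "continuous_on K g"
  shows "lsc_on K (\<lambda>z. f z + g z)"
  unfolding lsc_on_def
proof (intro ballI allI impI)
  fix z c assume z: "z \<in> K" and c: "c < f z + g z"
  define e where "e = (f z + g z - c) / 2"
  have e: "e > 0" using c by (simp add: e_def)
  have "\<forall>\<^sub>F w in at z within K. f z - e < f w"
    using assms(1) z e unfolding lsc_on_def by simp
  moreover have "\<forall>\<^sub>F w in at z within K. g z - e < g w"
    using assms(2) z e order_tendstoD(1)[of g "g z" "at z within K" "g z - e"]
    unfolding continuous_on_def by simp
  ultimately show "\<forall>\<^sub>F w in at z within K. c < f w + g w"
  proof eventually_elim
    case (elim w)
    moreover have "c = (f z - e) + (g z - e)" by (simp add: e_def field_simps)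
    ultimately show ?case by linarith
  qed
qed

lemma lsc_on_compose:
  fixes u :: "'b::topological_space \<Rightarrow> real"
  assumes "lsc_on Q u" "continuous_on K \<pi>" "\<pi> ` K \<subseteq> Q"
  shows "lsc_on K (\<lambda>k. u (\<pi> k))"
  unfolding lsc_on_def
proof (intro ballI allI impI)
  fix k c assume k: "k \<in> K" and c: "c < u (\<pi> k)"
  have "\<forall>\<^sub>F w in at (\<pi> k) within Q. c < u w"
    using assms k c unfolding lsc_on_def by blast
  then obtain U where U: "open U" "\<pi> k \<in> U" "\<forall>w\<in>U. w \<noteq> \<pi> k \<longrightarrow> w \<in> Q \<longrightarrow> c < u w"
    unfolding eventually_at_topological by blast
  have "\<forall>\<^sub>F l in at k within K. \<pi> l \<in> U"
    using assms(2) k U unfolding continuous_on_def by (metis topological_tendstoD)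
  moreover have "\<forall>\<^sub>F l in at k within K. l \<in> K"
    by (simp add: eventually_at_filter)
  ultimately show "\<forall>\<^sub>F l in at k within K. c < u (\<pi> l)"
  proof eventually_elim
    case (elim l)
    then show ?case using U c assms(3) by (cases "\<pi> l = \<pi> k") auto
  qed
qed

text \<open>
  As the penalty parameter grows, minimizers of \<open>f + j N\<close> have values at most \<open>f k0 = 0\<close>, so \<open>N\<close> tends
  to zero along them and every limit point lies in the zero set of \<open>N\<close>, with \<open>f \<le> 0\<close> there. This
  singles out \<open>k0\<close>. Since \<open>f\<close> is lower semicontinuous at \<open>k0\<close>, also the full penalty term \<open>j N\<close>
  tends to zero. This last bound is what later absorbs the error in the second derivatives.
\<close>

lemma penalized_minimizers_concentrate:
  fixes f N :: "'a::metric_space \<Rightarrow> real"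
  assumes K: "compact K" and f: "lsc_on K f" and N: "continuous_on K N" "\<And>k. k \<in> K \<Longrightarrow> N k \<ge> 0"
    and k0: "k0 \<in> K" "f k0 = 0" "N k0 = 0"
    and pos: "\<And>k. k \<in> K \<Longrightarrow> N k = 0 \<Longrightarrow> k \<noteq> k0 \<Longrightarrow> f k > 0"
    and e: "0 < e"
  obtains j k where "0 < j" "k \<in> K" "dist k k0 < e" "j * N k < e"
    "\<And>l. l \<in> K \<Longrightarrow> f k + j * N k \<le> f l + j * N l"
proof -
  have "\<exists>k\<in>K. \<forall>l\<in>K. f k + real j * N k \<le> f l + real j * N l" for j
    using k0 by (intro lsc_on_attains_inf K lsc_on_add_continuous f continuous_intros N) auto
  then obtain k where k: "\<And>j. k j \<in> K"
    and kmin: "\<And>j l. l \<in> K \<Longrightarrow> f (k j) + real j * N (k j) \<le> f l + real j * N l"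
    by metis
  have le0: "f (k j) + real j * N (k j) \<le> 0" for j
    using kmin[OF k0(1)] k0 by simp
  have fle0: "f (k j) \<le> 0" for j
    using le0[of j] mult_nonneg_nonneg[OF of_nat_0_le_iff[of j] N(2)[OF k[of j]]] by linarith
  obtain B where B: "\<And>l. l \<in> K \<Longrightarrow> B \<le> f l"
    using lsc_on_attains_inf[OF K _ f] k0 by (metis empty_iff)
  obtain l r where l: "l \<in> K" and r: "strict_mono r" and lim: "(k \<circ> r) \<longlonglongrightarrow> l"
    using K k unfolding compact_def by (metis (no_types, lifting))
  have kr: "(\<lambda>i. k (r i)) \<longlonglongrightarrow> l" using lim by (simp add: o_def)
  have Nlim: "(\<lambda>i. N (k (r i))) \<longlonglongrightarrow> N l"
    using continuous_on_tendsto_compose[OF N(1) kr l] k by simp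
  have rinf: "filterlim (\<lambda>i. real (r i)) at_top sequentially"
    using filterlim_compose[OF filterlim_real_sequentially filterlim_subseq[OF r]] .
  have "(\<lambda>i. - B / real (r i)) \<longlonglongrightarrow> 0"
    by (rule real_tendsto_divide_at_top[OF tendsto_const rinf])
  moreover have "\<forall>\<^sub>F i in sequentially. 0 < real (r i)"
    using rinf unfolding filterlim_at_top_dense by blast
  then have "\<forall>\<^sub>F i in sequentially. N (k (r i)) \<le> - B / real (r i)"
  proof eventually_elim
    case (elim i)
    then show ?case using le0[of "r i"] B[OF k[of "r i"]] by (simp add: field_simps)
  qed
  ultimately have "N l \<le> 0"
    using tendsto_le[OF trivial_limit_sequentially _ Nlim] by blast
  then have Nl: "N l = 0" using N(2)[OF l] by simp
  have ev: "\<forall>\<^sub>F i in sequentially. c < f (k (r i))" if "c < f l" for c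
  proof -
    have "\<forall>\<^sub>F w in at l within K. c < f w"
      using f l that unfolding lsc_on_def by blast
    then obtain U where U: "open U" "l \<in> U" "\<forall>w\<in>U. w \<noteq> l \<longrightarrow> w \<in> K \<longrightarrow> c < f w"
      unfolding eventually_at_topological by blast
    have "\<forall>\<^sub>F i in sequentially. k (r i) \<in> U"
      using kr U by (metis topological_tendstoD)
    then show ?thesis
      by eventually_elim (use U k that in metis)
  qed
  have "l = k0"
  proof (rule ccontr)
    assume "l \<noteq> k0"
    then have "0 < f l" using pos l Nl by blast
    then have "\<forall>\<^sub>F i in sequentially. False"
      using ev[of 0] fle0 by (simp add: not_less[symmetric])
    then show False by simp
  qed
  then have "\<forall>\<^sub>F i in sequentially. - e < f (k (r i))"
    using ev[of "- e"] k0 e by simp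
  moreover have "\<forall>\<^sub>F i in sequentially. dist (k (r i)) k0 < e"
    using kr \<open>l = k0\<close> e by (simp add: tendsto_iff)
  moreover have "\<forall>\<^sub>F i in sequentially. 0 < real (r i)"
    using rinf unfolding filterlim_at_top_dense by blast
  ultimately have "\<forall>\<^sub>F i in sequentially. - e < f (k (r i)) \<and> dist (k (r i)) k0 < e \<and> 0 < real (r i)"
    by eventually_elim auto
  then obtain i where i: "- e < f (k (r i))" "dist (k (r i)) k0 < e" "0 < real (r i)"
    by (auto simp: eventually_sequentially)
  have "real (r i) * N (k (r i)) < e" using le0[of "r i"] i by linarith
  then show ?thesis using that[of "real (r i)" "k (r i)"] i k kmin by blast
qed


section \<open>Horizontal second-order jets\<close>

abbreviation horiz_curve :: "'n::finite + 'n \<Rightarrow> real \<times> 'n heis \<Rightarrow> real \<Rightarrow> real \<times> 'n heis" where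
  "horiz_curve k z s \<equiv> (fst z, snd z + s *\<^sub>R horiz_field k (snd z))"

definition has_horiz_deriv ::
    "'n::finite + 'n \<Rightarrow> (real \<times> 'n heis \<Rightarrow> real) \<Rightarrow> real \<Rightarrow> real \<times> 'n heis \<Rightarrow> bool" where
  "has_horiz_deriv k f D z \<longleftrightarrow> ((\<lambda>s. f (horiz_curve k z s)) has_field_derivative D) (at 0)"

definition has_time_deriv :: "(real \<times> 'n::finite heis \<Rightarrow> real) \<Rightarrow> real \<Rightarrow> real \<times> 'n heis \<Rightarrow> bool" where
  "has_time_deriv f D z \<longleftrightarrow> ((\<lambda>t. f (t, snd z)) has_field_derivative D) (at (fst z))"

text \<open>
  \<open>G i\<close>, \<open>H i j\<close> and \<open>\<tau>\<close> stand for \<open>X\<^sub>i f\<close>, \<open>X\<^sub>i X\<^sub>j f\<close> and \<open>f\<^sub>t\<close>. Carrying them as explicit functions lets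
  the derivatives of a composite test function be read off from the rules below, whereas \<open>C2H\<close>
  speaks of them only through \<open>deriv\<close>.
\<close>

definition horiz_jet ::
    "(real \<times> 'n::finite heis) set \<Rightarrow> (real \<times> 'n heis \<Rightarrow> real) \<Rightarrow> ('n + 'n \<Rightarrow> real \<times> 'n heis \<Rightarrow> real) \<Rightarrow>
     ('n + 'n \<Rightarrow> 'n + 'n \<Rightarrow> real \<times> 'n heis \<Rightarrow> real) \<Rightarrow> (real \<times> 'n heis \<Rightarrow> real) \<Rightarrow> bool" where
  "horiz_jet U f G H \<tau> \<longleftrightarrow>
     continuous_on U f \<and> (\<forall>i. continuous_on U (G i)) \<and> (\<forall>i j. continuous_on U (H i j)) \<and>
     continuous_on U \<tau> \<and>
     (\<forall>z\<in>U. (\<forall>i. has_horiz_deriv i f (G i z) z) \<and>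
            (\<forall>i j. has_horiz_deriv i (G j) (H i j z) z) \<and> has_time_deriv f (\<tau> z) z)"

lemma has_horiz_deriv_imp: "has_horiz_deriv k f D z \<Longrightarrow> horiz_deriv k f z = D"
  unfolding has_horiz_deriv_def horiz_deriv_def by (rule DERIV_imp_deriv)

lemma has_time_deriv_imp: "has_time_deriv f D z \<Longrightarrow> time_deriv f z = D"
  unfolding has_time_deriv_def time_deriv_def by (rule DERIV_imp_deriv)

lemma horiz_differentiable_iff: "horiz_differentiable k f z \<longleftrightarrow> has_horiz_deriv k f (horiz_deriv k f z) z"
  unfolding horiz_differentiable_def has_horiz_deriv_def horiz_deriv_def
  by (metis DERIV_deriv_iff_real_differentiable)

lemma time_differentiable_iff: "time_differentiable f z \<longleftrightarrow> has_time_deriv f (time_deriv f z) z"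
  unfolding time_differentiable_def has_time_deriv_def time_deriv_def
  by (metis DERIV_deriv_iff_real_differentiable)

lemma C2H_imp_horiz_jet:
  "C2H U f \<Longrightarrow> horiz_jet U f (\<lambda>i. horiz_deriv i f) (\<lambda>i j. horiz_deriv i (horiz_deriv j f)) (time_deriv f)"
  unfolding C2H_def horiz_jet_def by (auto simp: horiz_differentiable_iff time_differentiable_iff)

lemma eventually_horiz_curve:
  assumes "open U" "z \<in> U"
  shows "\<forall>\<^sub>F s in nhds 0. horiz_curve k z s \<in> U"
proof -
  have "open ((\<lambda>s. horiz_curve k z s) -` U)"
    by (rule open_vimage[OF assms(1)]) (intro continuous_intros)
  moreover have "0 \<in> (\<lambda>s. horiz_curve k z s) -` U" using assms(2) by simp
  ultimately show ?thesis
    unfolding eventually_nhds by (intro exI[of _ "(\<lambda>s. horiz_curve k z s) -` U"]) simp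
qed

lemma eventually_time_line:
  assumes "open U" "z \<in> U"
  shows "\<forall>\<^sub>F t in nhds (fst z). (t, snd z) \<in> U"
proof -
  have "open ((\<lambda>t. (t, snd z)) -` U)"
    by (rule open_vimage[OF assms(1)]) (intro continuous_intros)
  moreover have "fst z \<in> (\<lambda>t. (t, snd z)) -` U" using assms(2) by simp
  ultimately show ?thesis
    unfolding eventually_nhds by (intro exI[of _ "(\<lambda>t. (t, snd z)) -` U"]) simp
qed

lemma has_horiz_deriv_cong:
  assumes "open U" "z \<in> U" "\<And>w. w \<in> U \<Longrightarrow> f w = g w"
  shows "has_horiz_deriv k f D z \<longleftrightarrow> has_horiz_deriv k g D z"
  unfolding has_horiz_deriv_def
  by (rule DERIV_cong_ev) (auto intro: eventually_mono[OF eventually_horiz_curve[OF assms(1,2)]] assms(3))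

lemma has_time_deriv_cong:
  assumes "open U" "z \<in> U" "\<And>w. w \<in> U \<Longrightarrow> f w = g w"
  shows "has_time_deriv f D z \<longleftrightarrow> has_time_deriv g D z"
  unfolding has_time_deriv_def
  by (rule DERIV_cong_ev) (auto intro: eventually_mono[OF eventually_time_line[OF assms(1,2)]] assms(3))

lemma horiz_jet_cong:
  assumes "open U" "\<forall>w\<in>U. f w = g w" "horiz_jet U f G H \<tau>"
  shows "horiz_jet U g G H \<tau>"
proof -
  have "continuous_on U g"
    by (rule continuous_on_eq[where f = f]) (use assms(2,3) in \<open>auto simp: horiz_jet_def\<close>)
  moreover have "has_horiz_deriv i g (G i z) z" if "z \<in> U" for i z
    using assms(3) that has_horiz_deriv_cong[OF assms(1) that, where f = f and g = g and k = i and D = "G i z"] assms(2)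
    unfolding horiz_jet_def by blast
  moreover have "has_time_deriv g (\<tau> z) z" if "z \<in> U" for z
    using assms(3) that has_time_deriv_cong[OF assms(1) that, where f = f and g = g and D = "\<tau> z"] assms(2)
    unfolding horiz_jet_def by blast
  ultimately show ?thesis
    using assms(3) unfolding horiz_jet_def by blast
qed

lemma horiz_jet_subset: "horiz_jet U f G H \<tau> \<Longrightarrow> V \<subseteq> U \<Longrightarrow> horiz_jet V f G H \<tau>"
  unfolding horiz_jet_def by (meson continuous_on_subset subsetD)

text \<open>
  Openness matters: \<open>X\<^sub>i X\<^sub>j f\<close> at \<open>z\<close> involves \<open>X\<^sub>j f\<close> near \<open>z\<close>, where it agrees with \<open>G j\<close> only
  inside \<open>U\<close>.
\<close>

lemma horiz_jet_derivs:
  assumes "open U" "horiz_jet U f G H \<tau>" "z \<in> U"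
  shows "horiz_deriv i f z = G i z" "horiz_deriv i (horiz_deriv j f) z = H i j z" "time_deriv f z = \<tau> z"
    and "horiz_differentiable i (horiz_deriv j f) z"
proof -
  have 1: "horiz_deriv i f w = G i w" if "w \<in> U" for i w
    using assms(2) that unfolding horiz_jet_def by (blast intro: has_horiz_deriv_imp)
  then show "horiz_deriv i f z = G i z" using assms(3) .
  have "has_horiz_deriv i (G j) (H i j z) z"
    using assms(2,3) unfolding horiz_jet_def by blast
  then have 2: "has_horiz_deriv i (horiz_deriv j f) (H i j z) z"
    using has_horiz_deriv_cong[OF assms(1,3), of "horiz_deriv j f" "G j"] 1 by blast
  then show "horiz_deriv i (horiz_deriv j f) z = H i j z" by (rule has_horiz_deriv_imp)
  with 2 show "horiz_differentiable i (horiz_deriv j f) z" by (simp add: horiz_differentiable_iff)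
  show "time_deriv f z = \<tau> z"
    using assms(2,3) unfolding horiz_jet_def by (blast intro: has_time_deriv_imp)
qed

lemma horiz_jet_imp_C2H:
  assumes "open U" "horiz_jet U f G H \<tau>"
  shows "C2H U f"
  unfolding C2H_def
proof (intro conjI allI ballI)
  note D = horiz_jet_derivs[OF assms]
  note J = assms(2)[unfolded horiz_jet_def]
  show "continuous_on U f" using J by blast
  show "continuous_on U (horiz_deriv i f)" for i
    by (rule continuous_on_eq[where f = "G i"]) (use J D(1) in auto)
  show "continuous_on U (horiz_deriv i (horiz_deriv j f))" for i j
    by (rule continuous_on_eq[where f = "H i j"]) (use J D(2) in auto)
  show "continuous_on U (time_deriv f)"
    by (rule continuous_on_eq[where f = "\<tau>"]) (use J D(3) in auto)
  show "horiz_differentiable i f z" if "z \<in> U" for i z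
    using J that D(1)[OF that] by (simp add: horiz_differentiable_iff)
  show "time_differentiable f z" if "z \<in> U" for z
    using J that D(3)[OF that] by (simp add: time_differentiable_iff)
  show "horiz_differentiable i (horiz_deriv j f) z" if "z \<in> U" for i j z
    using D(4)[OF that] .
qed

lemma C2H_if_locally:
  assumes "\<And>z. z \<in> Q \<Longrightarrow> \<exists>U. open U \<and> z \<in> U \<and> C2H U f"
  shows "C2H Q f"
proof -
  have cont: "continuous_on Q g"
    if "\<And>U. C2H U f \<Longrightarrow> continuous_on U g" for g
  proof (rule continuous_at_imp_continuous_on, rule ballI)
    fix z assume "z \<in> Q"
    then obtain U where "open U" "z \<in> U" "C2H U f" using assms by blast
    then show "isCont g z" using that by (metis continuous_on_eq_continuous_at)
  qed
  have pt: "P z" if "z \<in> Q" "\<And>U z. C2H U f \<Longrightarrow> z \<in> U \<Longrightarrow> P z" for P z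
    using assms that by blast
  show ?thesis
    unfolding C2H_def
  proof (intro conjI allI ballI)
    show "continuous_on Q f" by (rule cont) (simp add: C2H_def)
    show "continuous_on Q (horiz_deriv i f)" for i by (rule cont) (simp add: C2H_def)
    show "continuous_on Q (horiz_deriv i (horiz_deriv j f))" for i j by (rule cont) (simp add: C2H_def)
    show "continuous_on Q (time_deriv f)" by (rule cont) (simp add: C2H_def)
    show "horiz_differentiable i f z" if "z \<in> Q" for i z using that by (rule pt) (simp add: C2H_def)
    show "horiz_differentiable i (horiz_deriv j f) z" if "z \<in> Q" for i j z
      using that by (rule pt) (simp add: C2H_def)
    show "time_differentiable f z" if "z \<in> Q" for z using that by (rule pt) (simp add: C2H_def)
  qed
qed

lemma has_horiz_deriv_const: "has_horiz_deriv k (\<lambda>z. c) 0 z"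
  by (simp add: has_horiz_deriv_def)

lemma has_horiz_deriv_add:
  "has_horiz_deriv k f D z \<Longrightarrow> has_horiz_deriv k g E z \<Longrightarrow> has_horiz_deriv k (\<lambda>z. f z + g z) (D + E) z"
  unfolding has_horiz_deriv_def by (rule DERIV_add)

lemma has_horiz_deriv_mult:
  "has_horiz_deriv k f D z \<Longrightarrow> has_horiz_deriv k g E z \<Longrightarrow>
   has_horiz_deriv k (\<lambda>z. f z * g z) (D * g z + f z * E) z"
  unfolding has_horiz_deriv_def by (drule (1) DERIV_mult) (simp add: algebra_simps)

lemma has_horiz_deriv_compose:
  assumes "has_horiz_deriv k f D z" "(F has_field_derivative E) (at (f z))"
  shows "has_horiz_deriv k (\<lambda>z. F (f z)) (E * D) z"
  using assms DERIV_chain2[of F E "\<lambda>s. f (horiz_curve k z s)" 0 D UNIV] unfolding has_horiz_deriv_def by simp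

lemma horiz_jet_const: "horiz_jet U (\<lambda>z. c) (\<lambda>i z. 0) (\<lambda>i j z. 0) (\<lambda>z. 0)"
  by (simp add: horiz_jet_def has_horiz_deriv_const has_time_deriv_def)

lemma horiz_jet_add:
  assumes "horiz_jet U f G H \<tau>" "horiz_jet U f' G' H' \<tau>'"
  shows "horiz_jet U (\<lambda>z. f z + f' z) (\<lambda>i z. G i z + G' i z) (\<lambda>i j z. H i j z + H' i j z) (\<lambda>z. \<tau> z + \<tau>' z)"
  using assms unfolding horiz_jet_def
  by (auto intro!: continuous_intros has_horiz_deriv_add simp: has_time_deriv_def intro: DERIV_add)

lemma horiz_jet_mult:
  assumes "horiz_jet U f G H \<tau>" "horiz_jet U f' G' H' \<tau>'"
  shows "horiz_jet U (\<lambda>z. f z * f' z) (\<lambda>i z. G i z * f' z + f z * G' i z)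
    (\<lambda>i j z. (H i j z * f' z + G j z * G' i z) + (G i z * G' j z + f z * H' i j z))
    (\<lambda>z. \<tau> z * f' z + f z * \<tau>' z)"
  unfolding horiz_jet_def
proof (intro conjI allI ballI)
  note a = assms(1)[unfolded horiz_jet_def] and b = assms(2)[unfolded horiz_jet_def]
  show "continuous_on U (\<lambda>z. f z * f' z)" "continuous_on U (\<lambda>z. G i z * f' z + f z * G' i z)"
    "continuous_on U (\<lambda>z. (H i j z * f' z + G j z * G' i z) + (G i z * G' j z + f z * H' i j z))"
    "continuous_on U (\<lambda>z. \<tau> z * f' z + f z * \<tau>' z)" for i j
    using a b by (auto intro!: continuous_intros)
  fix z assume "z \<in> U"
  then show "has_horiz_deriv i (\<lambda>z. f z * f' z) (G i z * f' z + f z * G' i z) z"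
    "has_horiz_deriv i (\<lambda>z. G j z * f' z + f z * G' j z)
       ((H i j z * f' z + G j z * G' i z) + (G i z * G' j z + f z * H' i j z)) z" for i j
    using a b by (auto intro!: has_horiz_deriv_add has_horiz_deriv_mult)
  have "has_time_deriv f (\<tau> z) z" "has_time_deriv f' (\<tau>' z) z" using a b \<open>z \<in> U\<close> by auto
  then show "has_time_deriv (\<lambda>z. f z * f' z) (\<tau> z * f' z + f z * \<tau>' z) z"
    unfolding has_time_deriv_def by (auto dest: DERIV_mult simp: algebra_simps)
qed

lemma horiz_jet_cmult:
  assumes "horiz_jet U f G H \<tau>"
  shows "horiz_jet U (\<lambda>z. c * f z) (\<lambda>i z. c * G i z) (\<lambda>i j z. c * H i j z) (\<lambda>z. c * \<tau> z)"
  using horiz_jet_mult[OF horiz_jet_const[of U c] assms] by simp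

lemma horiz_jet_compose:
  assumes f: "horiz_jet U f G H \<tau>"
    and F: "\<And>s. (F has_field_derivative F' s) (at s)" "\<And>s. (F' has_field_derivative F'' s) (at s)"
      "continuous_on UNIV F''"
  shows "horiz_jet U (\<lambda>z. F (f z)) (\<lambda>i z. F' (f z) * G i z)
    (\<lambda>i j z. (F'' (f z) * G i z) * G j z + F' (f z) * H i j z) (\<lambda>z. F' (f z) * \<tau> z)"
  unfolding horiz_jet_def
proof (intro conjI allI ballI)
  note a = f[unfolded horiz_jet_def]
  have "continuous_on UNIV F" "continuous_on UNIV F'"
    using F(1,2) by (meson DERIV_isCont continuous_at_imp_continuous_on)+
  then have c: "continuous_on U (\<lambda>z. F (f z))" "continuous_on U (\<lambda>z. F' (f z))" "continuous_on U (\<lambda>z. F'' (f z))"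
    using F(3) a by (auto intro: continuous_on_compose2)
  show "continuous_on U (\<lambda>z. F (f z))" by fact
  show "continuous_on U (\<lambda>z. F' (f z) * G i z)"
    "continuous_on U (\<lambda>z. (F'' (f z) * G i z) * G j z + F' (f z) * H i j z)"
    "continuous_on U (\<lambda>z. F' (f z) * \<tau> z)" for i j
    using a c by (auto intro!: continuous_intros)
  fix z assume z: "z \<in> U"
  show "has_horiz_deriv i (\<lambda>z. F (f z)) (F' (f z) * G i z) z" for i
    using a z F(1) by (auto intro: has_horiz_deriv_compose)
  show "has_horiz_deriv i (\<lambda>z. F' (f z) * G j z) ((F'' (f z) * G i z) * G j z + F' (f z) * H i j z) z" for i j
    using a z by (intro has_horiz_deriv_mult has_horiz_deriv_compose F(2)) auto
  have "has_time_deriv f (\<tau> z) z" using a z by auto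
  then show "has_time_deriv (\<lambda>z. F (f z)) (F' (f z) * \<tau> z) z"
    using DERIV_chain2[of F "F' (f z)" "\<lambda>t. f (t, snd z)" "fst z" "\<tau> z" UNIV] F(1)
    unfolding has_time_deriv_def by simp
qed

text \<open>
  The horizontal derivatives of a left translate are the translates of the derivatives, so the class
  \<open>C2H\<close> is preserved. A right translate would involve the vertical derivative of \<open>f\<close>, which functions
  in this class are not assumed to have.
\<close>

lemma horiz_jet_left_translate:
  assumes f: "horiz_jet U f G H \<tau>" and V: "\<forall>z\<in>V. (fst z, heis_mult h (snd z)) \<in> U"
  defines "L \<equiv> \<lambda>z. (fst z, heis_mult h (snd z))"
  shows "horiz_jet V (\<lambda>z. f (L z)) (\<lambda>i z. G i (L z)) (\<lambda>i j z. H i j (L z)) (\<lambda>z. \<tau> (L z))"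
proof -
  note a = f[unfolded horiz_jet_def]
  have LV: "L z \<in> U" if "z \<in> V" for z
    using V that by (simp add: L_def)
  have cL: "continuous_on V (\<lambda>z. g (L z))" if "continuous_on U g" for g :: "real \<times> 'a heis \<Rightarrow> real"
    by (rule continuous_on_compose2[OF that]) (use LV in \<open>auto simp: L_def intro!: continuous_intros\<close>)
  have d: "has_horiz_deriv k (\<lambda>z. g (L z)) D z" if "has_horiz_deriv k g D (L z)" for g D k z
    using that by (simp add: has_horiz_deriv_def L_def heis_mult_horiz_field)
  have t: "has_time_deriv (\<lambda>z. g (L z)) D z" if "has_time_deriv g D (L z)" for g D z
    using that by (simp add: has_time_deriv_def L_def)
  show ?thesis
    unfolding horiz_jet_def using a LV by (auto intro!: cL d t)
qed

text \<open>
  Freezing the space variable of \<open>\<phi>\<close> leaves a test function whose horizontal derivatives come from the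
  penalty alone.
\<close>

lemma horiz_jet_freeze_space:
  assumes f: "horiz_jet U f G H \<tau>" and V: "\<forall>z\<in>V. (fst z, y) \<in> U"
  shows "horiz_jet V (\<lambda>z. f (fst z, y)) (\<lambda>i z. 0) (\<lambda>i j z. 0) (\<lambda>z. \<tau> (fst z, y))"
proof -
  note a = f[unfolded horiz_jet_def]
  have LV: "(fst z, y) \<in> U" if "z \<in> V" for z
    using V that by simp
  have c: "continuous_on V (\<lambda>z. g (fst z, y))" if "continuous_on U g" for g :: "real \<times> 'a heis \<Rightarrow> real"
    by (rule continuous_on_compose2[OF that]) (use LV in \<open>auto intro!: continuous_intros\<close>)
  have "has_time_deriv (\<lambda>z. f (fst z, y)) (\<tau> (fst z, y)) z" if "z \<in> V" for z
  proof -
    have "has_time_deriv f (\<tau> (fst z, y)) (fst z, y)" using a LV[OF that] by blast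
    then show ?thesis by (simp add: has_time_deriv_def)
  qed
  then show ?thesis
    unfolding horiz_jet_def using a c by (auto simp: has_horiz_deriv_def)
qed


section \<open>Localization of test functions\<close>

text \<open>
  The building block is \<open>P(s) = max(0, s)\<^sup>3 = (s\<^sup>3 + s\<^sup>2 |s|) / 2\<close>, which is twice continuously
  differentiable, and the cutoff is \<open>1 - P(1 - P(2 - s))\<close>.
\<close>

lemma smooth_cutoff:
  obtains F F' F'' :: "real \<Rightarrow> real" where
    "\<And>s. (F has_field_derivative F' s) (at s)" "\<And>s. (F' has_field_derivative F'' s) (at s)"
    "continuous_on UNIV F''" "\<And>s. 0 \<le> F s" "\<And>s. F s \<le> 1" "\<And>s. s \<le> 1 \<Longrightarrow> F s = 1" "\<And>s. 2 \<le> s \<Longrightarrow> F s = 0"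
proof -
  define P where "P = (\<lambda>s::real. (s ^ 3 + s * (s * \<bar>s\<bar>)) / 2)"
  define P' where "P' = (\<lambda>s::real. (3 * s\<^sup>2 + 3 * (s * \<bar>s\<bar>)) / 2)"
  define P'' where "P'' = (\<lambda>s::real. 3 * s + 3 * \<bar>s\<bar>)"
  have D: "((\<lambda>s. s * \<bar>s\<bar>) has_field_derivative 2 * \<bar>s\<bar>) (at s)" for s :: real
  proof (cases "s = 0")
    case True
    have "((\<lambda>h::real. \<bar>h\<bar>) \<longlongrightarrow> 0) (at 0)"
      by (rule tendsto_eq_intros refl | simp)+
    then have "((\<lambda>h::real. (h * \<bar>h\<bar>) / h) \<longlongrightarrow> 0) (at 0)"
      by (rule Lim_transform_eventually) (auto simp: eventually_at_filter)
    then show ?thesis using True by (simp add: DERIV_def)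
  next
    case False
    have "((\<lambda>x. x * (sgn s * x)) has_field_derivative 2 * \<bar>s\<bar>) (at s)"
      by (auto intro!: derivative_eq_intros simp: abs_sgn)
    moreover have "open {x. 0 < sgn s * x}" by (intro open_Collect_less continuous_intros)
    moreover have "s \<in> {x. 0 < sgn s * x}" using False by (simp add: abs_sgn[symmetric] mult.commute)
    moreover have "x * (sgn s * x) = x * \<bar>x\<bar>" if "x \<in> {x. 0 < sgn s * x}" for x
      using that False by (auto simp: sgn_if split: if_splits)
    ultimately show ?thesis by (rule has_field_derivative_transform_within_open)
  qed
  have DP: "(P has_field_derivative P' s) (at s)" for s
    unfolding P_def P'_def
    by (rule derivative_eq_intros D refl | simp add: power2_eq_square algebra_simps)+
  have DP': "(P' has_field_derivative P'' s) (at s)" for s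
    unfolding P'_def P''_def by (rule derivative_eq_intros D refl | simp add: algebra_simps)+
  have cP: "continuous_on A f \<Longrightarrow> continuous_on A (\<lambda>s. P (f s))"
    "continuous_on A f \<Longrightarrow> continuous_on A (\<lambda>s. P' (f s))"
    "continuous_on A f \<Longrightarrow> continuous_on A (\<lambda>s. P'' (f s))" for A :: "real set" and f
    unfolding P_def P'_def P''_def by (intro continuous_intros; simp)+
  have Pneg: "P s = 0" if "s \<le> 0" for s using that by (simp add: P_def power3_eq_cube)
  have Ppos: "P s = s ^ 3" if "0 \<le> s" for s using that by (simp add: P_def power3_eq_cube)
  have P0: "0 \<le> P s" for s using Pneg[of s] Ppos[of s] by (cases "0 \<le> s") auto
  have P1: "P s \<le> 1" if "s \<le> 1" for s
    using Pneg[of s] Ppos[of s] power_le_one[of s 3] that by (cases "0 \<le> s") auto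
  define F where "F = (\<lambda>s. 1 - P (1 - P (2 - s)))"
  define F' where "F' = (\<lambda>s. - (P' (1 - P (2 - s)) * P' (2 - s)))"
  define F'' where "F'' = (\<lambda>s. - (P'' (1 - P (2 - s)) * P' (2 - s) * P' (2 - s) - P' (1 - P (2 - s)) * P'' (2 - s)))"
  have D1: "((\<lambda>s. 1 - P (2 - s)) has_field_derivative P' (2 - s)) (at s)" for s
    by (rule derivative_eq_intros DERIV_chain2[OF DP] refl | simp)+
  show ?thesis
  proof
    show "(F has_field_derivative F' s) (at s)" for s
      unfolding F_def F'_def by (rule derivative_eq_intros DERIV_chain2[OF DP] D1 refl | simp)+
    show "(F' has_field_derivative F'' s) (at s)" for s
      unfolding F'_def F''_def
      by (rule derivative_eq_intros DERIV_chain2[OF DP'] D1 refl | simp add: algebra_simps)+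
    show "continuous_on UNIV F''"
      unfolding F''_def by (intro continuous_intros cP)
    show "0 \<le> F s" "F s \<le> 1" for s
      using P0 P1[of "1 - P (2 - s)"] by (auto simp: F_def)
    show "F s = 1" if "s \<le> 1" for s
    proof -
      have "1 \<le> P (2 - s)" using that Ppos[of "2 - s"] one_le_power[of "2 - s" 3] by simp
      then show ?thesis by (simp add: F_def Pneg)
    qed
    show "F s = 0" if "2 \<le> s" for s
      using that Pneg[of "2 - s"] Ppos[of 1] by (simp add: F_def)
  qed
qed

text \<open>
  The squared Euclidean distance localizes the test functions and makes contact strict. It
  vanishes at \<open>z1\<close> together with its horizontal gradient, so subtracting its square changes neither
  the horizontal derivatives of order at most two nor the time derivative at that point.
\<close>

lemma horiz_jet_dist_sq:
  fixes z1 :: "real \<times> 'n::finite heis"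
  shows "horiz_jet U (\<lambda>z. (dist z z1)\<^sup>2)
    (\<lambda>i z. 2 * (fst (snd z) - fst (snd z1)) $ i
            + 2 * (snd (snd z) - snd (snd z1)) * symp (fst (snd z)) (axis i 1))
    (\<lambda>i j z. 2 * axis i 1 $ j + 2 * symp (fst (snd z)) (axis i 1) * symp (fst (snd z)) (axis j 1)
            + 2 * (snd (snd z) - snd (snd z1)) * symp (axis i 1) (axis j 1))
    (\<lambda>z. 2 * (fst z - fst z1))"
proof -
  have r: "(dist z z1)\<^sup>2 = (fst z - fst z1)\<^sup>2
      + (fst (snd z) - fst (snd z1)) \<bullet> (fst (snd z) - fst (snd z1))
      + (snd (snd z) - snd (snd z1))\<^sup>2" for z
    by (simp add: dist_prod_def dist_real_def power2_norm_eq_inner[symmetric] dist_norm)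
  have sq: "(a + s *\<^sub>R axis i 1 - b) \<bullet> (a + s *\<^sub>R axis i 1 - b)
      = (a - b) \<bullet> (a - b) + 2 * s * (a - b) $ i + s\<^sup>2" for a b :: "real ^ ('n + 'n)" and s i
    by (simp add: inner_simps inner_axis' inner_axis inner_axis_axis power2_eq_square algebra_simps)
  show ?thesis
    unfolding horiz_jet_def r has_horiz_deriv_def has_time_deriv_def horiz_field_eq
    by (auto intro!: continuous_intros derivative_eq_intros simp: sq symp_simps inner_axis inner_axis' algebra_simps)
qed

text \<open>
  Supersolutions in the sense of the weaker test at critical points. Subsolutions are treated
  through this notion as well, by changing the sign of \<open>u\<close>.
\<close>

definition weak_supersol :: "real \<Rightarrow> (real \<times> 'n::finite heis) set \<Rightarrow> (real \<times> 'n heis \<Rightarrow> real) \<Rightarrow> bool" where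
  "weak_supersol p Q u \<longleftrightarrow>
    (\<forall>z0\<in>Q. \<forall>\<phi>.
       C2H Q \<phi> \<and> u z0 = \<phi> z0 \<and> (\<forall>z\<in>Q. z \<noteq> z0 \<longrightarrow> u z > \<phi> z) \<longrightarrow>
       (horiz_grad \<phi> z0 \<noteq> 0 \<longrightarrow>
          time_deriv \<phi> z0 \<ge> (p - 2) * horiz_inf_laplacian \<phi> z0 + horiz_laplacian \<phi> z0) \<and>
       (horiz_grad \<phi> z0 = 0 \<and> sym_horiz_hess \<phi> z0 = 0 \<longrightarrow> time_deriv \<phi> z0 \<ge> 0))"

text \<open>
  Test functions have to be defined and to lie below \<open>u\<close> on all of \<open>Q\<close>, but the ones constructed
  below make sense only near the contact point. Since one global function \<open>\<phi> \<le> u\<close> is at hand, a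
  local \<open>\<psi> \<le> u\<close> can be extended by the convex combination \<open>\<zeta> \<psi> + (1 - \<zeta>) \<phi>\<close>, where \<open>\<zeta>\<close> is a cutoff
  around \<open>z1\<close>. It still lies below \<open>u\<close>, and subtracting the fourth power of the distance to \<open>z1\<close>
  makes the contact strict.
\<close>

lemma weak_supersol_local_test:
  fixes u :: "real \<times> 'n::finite heis \<Rightarrow> real"
  assumes Q: "open Q" and u: "weak_supersol p Q u"
    and \<phi>: "C2H Q \<phi>" "\<And>z. z \<in> Q \<Longrightarrow> \<phi> z \<le> u z"
    and U: "open U" "z1 \<in> U" "U \<subseteq> Q"
    and \<psi>: "horiz_jet U \<psi> G H \<tau>" "\<psi> z1 = u z1" "\<And>z. z \<in> U \<Longrightarrow> \<psi> z \<le> u z"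
    and g: "\<And>i. g $ i = G i z1" and S: "\<And>i j. S $ i $ j = (H i j z1 + H j i z1) / 2"
  shows "(g \<noteq> 0 \<longrightarrow> (p - 2) * ((S *v g) \<bullet> g / (norm g)\<^sup>2) + (\<Sum>i\<in>UNIV. S $ i $ i) \<le> \<tau> z1) \<and>
    (g = 0 \<and> S = 0 \<longrightarrow> 0 \<le> \<tau> z1)"
proof -
  obtain \<rho> where \<rho>: "0 < \<rho>" "ball z1 \<rho> \<subseteq> U"
    using U open_contains_ball by blast
  \<comment> \<open>In terms of the squared distance \<open>r\<close> to \<open>z1\<close>, the cutoff vanishes for \<open>r > 2 c\<close> while \<open>U\<close> contains \<open>r < 3 c\<close>.\<close>
  define c where "c = \<rho>\<^sup>2 / 3"
  have c: "0 < c" using \<rho> by (simp add: c_def)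
  define r where "r = (\<lambda>z. (dist z z1)\<^sup>2)"
  obtain F F' F'' :: "real \<Rightarrow> real" where F:
    "\<And>s. (F has_field_derivative F' s) (at s)" "\<And>s. (F' has_field_derivative F'' s) (at s)"
    "continuous_on UNIV F''" and F01: "\<And>s. 0 \<le> F s" "\<And>s. F s \<le> 1"
    and F1: "\<And>s. s \<le> 1 \<Longrightarrow> F s = 1" and F0: "\<And>s. 2 \<le> s \<Longrightarrow> F s = 0"
    using smooth_cutoff by blast
  define \<zeta> where "\<zeta> = (\<lambda>z. F ((1 / c) * r z))"
  \<comment> \<open>Written with sums and products only, so that the jet rules apply to it literally.\<close>
  define f where "f = (\<lambda>z. (\<zeta> z * \<psi> z + (1 + (- 1) * \<zeta> z) * \<phi> z) + (- 1) * (r z * r z))"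
  have in_U: "z \<in> U" if "r z < 3 * c" for z
  proof -
    have "dist z z1 < \<rho>"
      using that \<rho>(1) by (auto simp: r_def c_def intro: power_less_imp_less_base)
    then show ?thesis using \<rho>(2) by (auto simp: dist_commute)
  qed
  have r0: "r z1 = 0" "\<And>z. z \<noteq> z1 \<Longrightarrow> 0 < r z" by (auto simp: r_def)
  have \<zeta>1: "\<zeta> z = 1" if "r z < c" for z
    unfolding \<zeta>_def using that c by (intro F1) (simp add: field_simps)
  have \<zeta>0: "\<zeta> z = 0" if "2 * c < r z" for z
    unfolding \<zeta>_def using that c by (intro F0) (simp add: field_simps)
  note jr = horiz_jet_dist_sq[of _ z1, folded r_def]
  note jrr = horiz_jet_cmult[OF horiz_jet_mult[OF jr jr], of _ "- 1"]
  note j\<zeta> = horiz_jet_compose[OF horiz_jet_cmult[OF jr, of _ "1 / c"] F, folded \<zeta>_def]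
  note j\<phi> = C2H_imp_horiz_jet[OF \<phi>(1)]
  have r_cont: "continuous_on UNIV r" unfolding r_def by (intro continuous_intros)
  define W where "W = U \<inter> {z. r z < c}"
  define V where "V = Q \<inter> {z. 2 * c < r z}"
  have op: "open W" "open V"
    unfolding W_def V_def using U(1) Q r_cont by (auto intro!: open_Int open_Collect_less continuous_intros)
  have z1W: "z1 \<in> W" using U(2) r0 c by (simp add: W_def)
  have CU: "C2H U f"
    unfolding f_def
    by (rule horiz_jet_imp_C2H[OF U(1)],
        rule horiz_jet_add[OF horiz_jet_add[OF horiz_jet_mult[OF j\<zeta> \<psi>(1)]
          horiz_jet_mult[OF horiz_jet_add[OF horiz_jet_const horiz_jet_cmult[OF j\<zeta>]]
             horiz_jet_subset[OF j\<phi> U(3)]]] jrr])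
  have VQ: "V \<subseteq> Q" by (simp add: V_def)
  have CV: "C2H V f"
    by (rule horiz_jet_imp_C2H[OF op(2)],
        rule horiz_jet_cong[OF op(2) _ horiz_jet_add[OF horiz_jet_subset[OF j\<phi> VQ] jrr]])
       (auto simp: f_def V_def \<zeta>0)
  have "C2H Q f"
  proof (rule C2H_if_locally)
    fix z assume "z \<in> Q"
    then have "z \<in> U \<or> z \<in> V" using in_U[of z] c by (force simp: V_def)
    then show "\<exists>U. open U \<and> z \<in> U \<and> C2H U f" using CU CV U(1) op by blast
  qed
  moreover have "u z1 = f z1"
    using \<zeta>1[of z1] r0 c \<psi>(2) by (simp add: f_def)
  moreover have "f z < u z" if z: "z \<in> Q" "z \<noteq> z1" for z
  proof -
    have "\<zeta> z * \<psi> z + (1 + (- 1) * \<zeta> z) * \<phi> z \<le> u z"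
    proof (cases "z \<in> U")
      case True
      have "\<zeta> z * \<psi> z \<le> \<zeta> z * u z" "(1 - \<zeta> z) * \<phi> z \<le> (1 - \<zeta> z) * u z"
        using F01 \<psi>(3)[OF True] \<phi>(2)[OF z(1)] by (auto simp: \<zeta>_def intro!: mult_left_mono)
      then show ?thesis by (simp add: algebra_simps)
    next
      case False
      then have "\<zeta> z = 0" using in_U[of z] c by (intro \<zeta>0) force
      then show ?thesis using \<phi>(2)[OF z(1)] by simp
    qed
    moreover have "0 < r z * r z" using r0(2)[OF z(2)] by simp
    ultimately show ?thesis unfolding f_def by linarith
  qed
  ultimately have T: "(horiz_grad f z1 \<noteq> 0 \<longrightarrow>
      time_deriv f z1 \<ge> (p - 2) * horiz_inf_laplacian f z1 + horiz_laplacian f z1) \<and>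
    (horiz_grad f z1 = 0 \<and> sym_horiz_hess f z1 = 0 \<longrightarrow> time_deriv f z1 \<ge> 0)"
    using u[unfolded weak_supersol_def, THEN bspec, OF subsetD[OF U(3,2)], THEN spec, of f] by blast
  have eqW: "\<forall>w\<in>W. \<psi> w + - 1 * (r w * r w) = f w"
    by (simp add: f_def W_def \<zeta>1)
  have WU: "W \<subseteq> U" by (simp add: W_def)
  note D = horiz_jet_derivs[OF op(1)
      horiz_jet_cong[OF op(1) eqW horiz_jet_add[OF horiz_jet_subset[OF \<psi>(1) WU] jrr]] z1W]
  have "horiz_deriv i f z1 = G i z1" "horiz_deriv i (horiz_deriv j f) z1 = H i j z1"
    "time_deriv f z1 = \<tau> z1" for i j
    unfolding D by (simp_all add: r0)
  then have "horiz_grad f z1 = g" "sym_horiz_hess f z1 = S"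
    "horiz_laplacian f z1 = (\<Sum>i\<in>UNIV. S $ i $ i)" "time_deriv f z1 = \<tau> z1"
    by (simp_all add: horiz_grad_def sym_horiz_hess_def horiz_laplacian_def g S vec_eq_iff)
  with T show ?thesis by (simp add: horiz_inf_laplacian_def)
qed


section \<open>The quartic gauge as a penalty\<close>

text \<open>
  The penalty is \<open>N(x\<^sup>-\<^sup>1 \<circ> y)\<close> with \<open>N(g) = |g'|\<^sup>4 + g\<^sub>v\<^sup>4\<close>, where \<open>g'\<close> and \<open>g\<^sub>v\<close> are the horizontal and
  vertical components of \<open>g\<close>. The vertical exponent is four instead of the homogeneous two: then \<open>N\<close>
  dominates \<open>2 |g'|\<^sup>2 g\<^sub>v\<^sup>2\<close>, which up to a factor bounds the Hessian in
  \<open>horiz_jet_gauge_translate\<close>.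
\<close>

definition quartic_gauge :: "'n::finite heis \<Rightarrow> real" where
  "quartic_gauge g = (fst g \<bullet> fst g)\<^sup>2 + snd g ^ 4"

lemma heis_mult_uminus_eq:
  "heis_mult (- x) y = (fst y - fst x, snd y - snd x - symp (fst x) (fst y))"
  by (simp add: heis_mult_eq symp_simps)

lemma quartic_gauge_nonneg: "0 \<le> quartic_gauge g"
  by (simp add: quartic_gauge_def)

lemma quartic_gauge_eq_0_iff: "quartic_gauge (heis_mult (- x) y) = 0 \<longleftrightarrow> x = y"
proof -
  have "quartic_gauge g = 0 \<longleftrightarrow> g = 0" for g :: "'a heis"
    by (auto simp: quartic_gauge_def add_nonneg_eq_0_iff prod_eq_iff)
  then show ?thesis by (auto simp: heis_mult_uminus_eq prod_eq_iff)
qed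

lemma continuous_on_quartic_gauge [continuous_intros]:
  "continuous_on A f \<Longrightarrow> continuous_on A (\<lambda>z. quartic_gauge (f z))"
  unfolding quartic_gauge_def by (intro continuous_intros)

lemma inner_add_axis:
  "(a + s *\<^sub>R axis i 1) \<bullet> (a + s *\<^sub>R axis i 1) = a \<bullet> a + 2 * s * a $ i + s\<^sup>2"
  for a :: "real ^ 'm::finite"
  by (simp add: inner_simps inner_axis' inner_axis inner_axis_axis power2_eq_square algebra_simps)

text \<open>
  For \<open>y\<close> fixed, as a function of \<open>x\<close>. Where \<open>y' = x'\<close>, the gradient is zero and the Hessian is the
  antisymmetric matrix \<open>- 4 g\<^sub>v\<^sup>3 \<omega>(e\<^sub>i, e\<^sub>k)\<close>, so the symmetrized Hessian vanishes even if the vertical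
  coordinates of the points differ.
\<close>

lemma horiz_jet_gauge_left:
  fixes y :: "'n::finite heis"
  defines "d \<equiv> \<lambda>z. fst y - fst (snd z)" and "w \<equiv> \<lambda>z. snd y - snd (snd z) - symp (fst (snd z)) (fst y)"
  shows "horiz_jet U (\<lambda>z. quartic_gauge (heis_mult (- snd z) y))
    (\<lambda>k z. - 4 * (d z \<bullet> d z) * d z $ k + 4 * w z ^ 3 * symp (d z) (axis k 1))
    (\<lambda>i k z. 8 * d z $ i * d z $ k + 4 * (d z \<bullet> d z) * axis i 1 $ k
       - 4 * w z ^ 3 * symp (axis i 1) (axis k 1)
       + 12 * (w z)\<^sup>2 * symp (d z) (axis i 1) * symp (d z) (axis k 1))
    (\<lambda>z. 0 :: real)"
proof -
  have dc: "d (horiz_curve i z s) = d z + (- s) *\<^sub>R axis i 1" for i z s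
    by (simp add: d_def horiz_field_eq algebra_simps)
  have wc: "w (horiz_curve i z s) = w z + s * symp (d z) (axis i 1)" for i z s
    using symp_commute[of "axis i 1" "fst y"]
    by (simp add: w_def d_def horiz_field_eq symp_simps algebra_simps)
  have g: "quartic_gauge (heis_mult (- snd z) y) = (d z \<bullet> d z)\<^sup>2 + w z ^ 4" for z :: "real \<times> 'n heis"
    by (simp add: quartic_gauge_def heis_mult_uminus_eq d_def w_def)
  have cd: "continuous_on U d" "continuous_on U w"
    unfolding d_def w_def by (intro continuous_intros)+
  have 1: "has_horiz_deriv k (\<lambda>z. (d z \<bullet> d z)\<^sup>2 + w z ^ 4)
      (- 4 * (d z \<bullet> d z) * d z $ k + 4 * w z ^ 3 * symp (d z) (axis k 1)) z" for k z
    unfolding has_horiz_deriv_def dc wc inner_add_axis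
    by (auto intro!: derivative_eq_intros)
  have 2: "has_horiz_deriv i (\<lambda>z. - 4 * (d z \<bullet> d z) * d z $ k + 4 * w z ^ 3 * symp (d z) (axis k 1))
      (8 * d z $ i * d z $ k + 4 * (d z \<bullet> d z) * axis i 1 $ k
       - 4 * w z ^ 3 * symp (axis i 1) (axis k 1)
       + 12 * (w z)\<^sup>2 * symp (d z) (axis i 1) * symp (d z) (axis k 1)) z" for i k z
    unfolding has_horiz_deriv_def dc wc inner_add_axis symp_simps vector_add_component vector_scaleR_component
    by (auto intro!: derivative_eq_intros simp: algebra_simps)
  show ?thesis
    unfolding horiz_jet_def g
    using 1 2 by (auto intro!: continuous_intros cd simp: has_time_deriv_def g[symmetric])
qed

text \<open>
  When \<open>y = h \<circ> x\<close> moves along with \<open>x\<close>, the horizontal part of \<open>x\<^sup>-\<^sup>1 \<circ> h \<circ> x\<close> is constant and its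
  vertical part is affine in \<open>x\<close>. The derivatives therefore contain only the small quantity \<open>h'\<close>.
\<close>

lemma horiz_jet_gauge_translate:
  fixes h :: "'n::finite heis"
  defines "w \<equiv> \<lambda>z. snd h + 2 * symp (fst h) (fst (snd z))"
  shows "horiz_jet U (\<lambda>z. quartic_gauge (heis_mult (- snd z) (heis_mult h (snd z))))
    (\<lambda>k z. 8 * w z ^ 3 * symp (fst h) (axis k 1))
    (\<lambda>i k z. 48 * (w z)\<^sup>2 * symp (fst h) (axis i 1) * symp (fst h) (axis k 1))
    (\<lambda>z. 0 :: real)"
proof -
  have g: "quartic_gauge (heis_mult (- snd z) (heis_mult h (snd z))) = (fst h \<bullet> fst h)\<^sup>2 + w z ^ 4"
    for z :: "real \<times> 'n heis"
    using symp_commute[of "fst (snd z)" "fst h"]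
    by (simp add: quartic_gauge_def heis_mult_eq w_def symp_simps add.commute)
  have wc: "w (horiz_curve i z s) = w z + s * (2 * symp (fst h) (axis i 1))" for i z s
    by (simp add: w_def horiz_field_eq symp_simps algebra_simps)
  have cd: "continuous_on U w"
    unfolding w_def by (intro continuous_intros)
  have 1: "has_horiz_deriv k (\<lambda>z. (fst h \<bullet> fst h)\<^sup>2 + w z ^ 4) (8 * w z ^ 3 * symp (fst h) (axis k 1)) z" for k z
    unfolding has_horiz_deriv_def wc by (auto intro!: derivative_eq_intros)
  have 2: "has_horiz_deriv i (\<lambda>z. 8 * w z ^ 3 * symp (fst h) (axis k 1))
      (48 * (w z)\<^sup>2 * symp (fst h) (axis i 1) * symp (fst h) (axis k 1)) z" for i k z
    unfolding has_horiz_deriv_def wc by (auto intro!: derivative_eq_intros)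
  show ?thesis
    unfolding horiz_jet_def g
    using 1 2 by (auto intro!: continuous_intros cd simp: has_time_deriv_def w_def)
qed

text \<open>
  \<open>X\<^sub>k\<close> is constant along its integral lines because \<open>\<omega>(e\<^sub>k, e\<^sub>k) = 0\<close>, so the derivative at parameter
  \<open>s\<close> is the derivative at parameter \<open>0\<close> of the line through the shifted point.
\<close>

lemma has_horiz_deriv_along_curve:
  assumes "has_horiz_deriv k f D (horiz_curve k z s)"
  shows "((\<lambda>s. f (horiz_curve k z s)) has_field_derivative D) (at s)"
proof -
  have "horiz_field k (snd z + s *\<^sub>R horiz_field k (snd z)) = horiz_field k (snd z)"
    by (simp add: horiz_field_eq symp_simps)
  then have "((\<lambda>\<sigma>. f (horiz_curve k z (\<sigma> + s))) has_field_derivative D) (at 0)"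
    using assms by (simp add: has_horiz_deriv_def scaleR_add_left ac_simps)
  then show ?thesis using DERIV_shift[of "\<lambda>s. f (horiz_curve k z s)" D 0 s] by simp
qed

text \<open>
  If the second derivative were positive, \<open>f'\<close> would be positive just to the right of \<open>0\<close>, and \<open>f\<close> would
  exceed \<open>f 0\<close> there.
\<close>

lemma second_deriv_nonpos_at_local_max:
  fixes f f' :: "real \<Rightarrow> real"
  assumes f: "\<forall>\<^sub>F s in nhds 0. (f has_field_derivative f' s) (at s)"
    and f': "(f' has_field_derivative D) (at 0)"
    and max: "\<forall>\<^sub>F s in nhds 0. f s \<le> f 0"
  shows "D \<le> 0"
proof (rule ccontr)
  assume "\<not> D \<le> 0"
  obtain e where e: "0 < e" "\<And>s. \<bar>s\<bar> < e \<Longrightarrow> (f has_field_derivative f' s) (at s) \<and> f s \<le> f 0"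
    using eventually_conj[OF f max] by (auto simp: eventually_nhds_metric)
  have "f' 0 = 0"
    using e by (intro DERIV_local_max[of f "f' 0" 0 e]) auto
  then obtain d where d: "0 < d" "\<And>s. 0 < s \<Longrightarrow> s < d \<Longrightarrow> 0 < f' s"
    using DERIV_pos_inc_right[OF f'] \<open>\<not> D \<le> 0\<close> by auto
  define b where "b = min d e / 2"
  have b: "0 < b" "b < d" "b < e" using d e by (auto simp: b_def)
  have "\<exists>s>0. s < b \<and> f b - f 0 = (b - 0) * f' s"
    by (rule MVT2[OF b(1)]) (use b e in auto)
  then obtain s where s: "0 < s" "s < b" "f b - f 0 = (b - 0) * f' s" by blast
  have "0 < b * f' s" using d(2)[of s] s b by simp
  then show False using s(3) e(2)[of b] b by simp
qed

section \<open>The inequality at critical points\<close>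

text \<open>
  The function \<open>u(t, x) - \<phi>(t, y) + j N(x\<^sup>-\<^sup>1 \<circ> y)\<close> is minimized at some \<open>(t, x, y)\<close> close to \<open>(t0, x0, x0)\<close>;
  let \<open>h = y \<circ> x\<^sup>-\<^sup>1\<close>. Restricting it to \<open>y = h \<circ> x\<close> shows that \<open>\<phi>(t, h \<circ> x) - j N(x\<^sup>-\<^sup>1 \<circ> h \<circ> x)\<close> touches
  \<open>u\<close> from below up to a constant. If its gradient is not zero, the hypothesis applies, and \<open>R\<close> is
  the contribution of the penalty to the Hessian.

  If this gradient is zero, it is compared with the gradient of \<open>\<phi>\<close> obtained by varying \<open>y\<close> alone.
  With \<open>d = y' - x'\<close> and \<open>w\<close> the vertical part of \<open>x\<^sup>-\<^sup>1 \<circ> y\<close>, the two equations are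
  \<open>X\<^sub>k \<phi> = 8 j w\<^sup>3 \<omega>(d, e\<^sub>k)\<close> and \<open>X\<^sub>k \<phi> = j (4 |d|\<^sup>2 d\<^sub>k + 4 w\<^sup>3 \<omega>(d, e\<^sub>k))\<close>. Hence \<open>|d|\<^sup>2 d\<^sub>k = w\<^sup>3 \<omega>(d, e\<^sub>k)\<close>,
  and pairing with \<open>d\<close> gives \<open>|d|\<^sup>4 = 0\<close>. Now varying \<open>x\<close> alone provides a test function for \<open>u\<close>
  whose gradient and symmetrized Hessian are zero, while varying \<open>y\<close> along \<open>X\<^sub>k\<close> gives
  \<open>X\<^sub>k X\<^sub>k \<phi> \<le> 0\<close>, because for \<open>d = 0\<close> the penalty along this line is \<open>s\<^sup>4 + w\<^sup>4\<close>.
\<close>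

lemma touching_alternative:
  fixes u :: "real \<times> 'n::finite heis \<Rightarrow> real"
  assumes Q: "open Q" and u: "weak_supersol p Q u" "lsc_on Q u"
    and \<phi>: "C2H Q \<phi>" and z0: "z0 \<in> Q" "u z0 = \<phi> z0" and below: "\<And>z. z \<in> Q \<Longrightarrow> z \<noteq> z0 \<Longrightarrow> \<phi> z < u z"
    and e: "0 < e"
  obtains z R where "z \<in> Q" "dist z z0 < e" "\<And>i j. \<bar>R $ i $ j\<bar> \<le> e"
    "(\<exists>g. g \<noteq> 0 \<and> (p - 2) * (((sym_horiz_hess \<phi> z - R) *v g) \<bullet> g / (norm g)\<^sup>2)
        + (\<Sum>i\<in>UNIV. (sym_horiz_hess \<phi> z - R) $ i $ i) \<le> time_deriv \<phi> z)
     \<or> 0 \<le> time_deriv \<phi> z \<and> (\<forall>k. horiz_deriv k (horiz_deriv k \<phi>) z \<le> 0)"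
proof -
  obtain t0 x0 where z0_eq: "z0 = (t0, x0)" by (cases z0)
  obtain \<rho> where \<rho>: "0 < \<rho>" "cball z0 \<rho> \<subseteq> Q"
    using Q z0 open_contains_cball by blast
  define r where "r = \<rho> / 2"
  have r: "0 < r" using \<rho> by (simp add: r_def)
  have inQ: "(t, x) \<in> Q" if "dist t t0 \<le> r" "dist x x0 \<le> r" for t x
  proof -
    have "dist (t, x) z0 \<le> dist t t0 + dist x x0"
      unfolding z0_eq dist_Pair_Pair by (rule sqrt_sum_squares_le_sum) auto
    then have "dist (t, x) z0 \<le> \<rho>" using that by (simp add: r_def)
    then show ?thesis using \<rho>(2) by (auto simp: dist_commute)
  qed
  define K where "K = cball t0 r \<times> cball x0 r \<times> cball x0 r"
  define N where "N = (\<lambda>k :: real \<times> 'n heis \<times> 'n heis. quartic_gauge (heis_mult (- fst (snd k)) (snd (snd k))))"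
  define f where "f = (\<lambda>k :: real \<times> 'n heis \<times> 'n heis. u (fst k, fst (snd k)) + - \<phi> (fst k, snd (snd k)))"
  have cK: "compact K" unfolding K_def by (intro compact_Times compact_cball)
  have \<phi>c: "continuous_on Q \<phi>" using \<phi> by (simp add: C2H_def)
  have lscf: "lsc_on K f"
    unfolding f_def
  proof (rule lsc_on_add_continuous[OF lsc_on_compose[OF u(2)]])
    show "continuous_on K (\<lambda>k. (fst k, fst (snd k)))" by (intro continuous_intros)
    show "(\<lambda>k. (fst k, fst (snd k))) ` K \<subseteq> Q"
      by (auto simp: K_def dist_commute intro: inQ)
    show "continuous_on K (\<lambda>k. - \<phi> (fst k, snd (snd k)))"
      by (intro continuous_intros continuous_on_compose2[OF \<phi>c])
         (auto simp: K_def dist_commute intro: inQ)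
  qed
  \<comment> \<open>The entries of \<open>R\<close> will be bounded by \<open>96 j N\<close>; staying within \<open>r\<close> makes the minimizer interior.\<close>
  define \<epsilon> where "\<epsilon> = min r (e / 96)"
  have \<epsilon>: "0 < \<epsilon>" "\<epsilon> \<le> r" "96 * \<epsilon> \<le> e" using e r by (auto simp: \<epsilon>_def)
  obtain j k where j: "0 < j" and k: "k \<in> K" "dist k (t0, x0, x0) < \<epsilon>" and jN: "j * N k < \<epsilon>"
    and kmin: "\<And>l. l \<in> K \<Longrightarrow> f k + j * N k \<le> f l + j * N l"
  proof (rule penalized_minimizers_concentrate[OF cK lscf, of N "(t0, x0, x0)" \<epsilon>])
    show "continuous_on K N" unfolding N_def by (intro continuous_intros)
    show "0 \<le> N k" for k by (simp add: N_def quartic_gauge_nonneg)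
    show "(t0, x0, x0) \<in> K" using r by (simp add: K_def)
    show "f (t0, x0, x0) = 0" using z0 by (simp add: f_def z0_eq)
    show "N (t0, x0, x0) = 0" by (simp add: N_def quartic_gauge_eq_0_iff)
    show "0 < f k" if pr: "k \<in> K" "N k = 0" "k \<noteq> (t0, x0, x0)" for k
    proof -
      obtain t x where k: "k = (t, x, x)"
        using pr(2) by (cases k) (auto simp: N_def quartic_gauge_eq_0_iff)
      have "(t, x) \<in> Q" using pr(1) by (auto simp: k K_def dist_commute intro: inQ)
      then show ?thesis using below[of "(t, x)"] pr(3) by (auto simp: k f_def z0_eq)
    qed
    show "0 < \<epsilon>" by fact
  qed (use that in blast)
  obtain t x y where k_eq: "k = (t, x, y)" by (cases k)
  have near: "dist t t0 < \<epsilon>" "dist x x0 < \<epsilon>" "dist (t, y) z0 < \<epsilon>" "dist y x0 < \<epsilon>"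
  proof -
    have "dist t t0 \<le> dist k (t0, x0, x0)" "dist x x0 \<le> dist k (t0, x0, x0)" "dist y x0 \<le> dist k (t0, x0, x0)"
      "dist (t, y) z0 \<le> dist k (t0, x0, x0)"
      by (auto simp: k_eq z0_eq dist_Pair_Pair intro!: real_le_rsqrt real_sqrt_le_mono)
    then show "dist t t0 < \<epsilon>" "dist x x0 < \<epsilon>" "dist (t, y) z0 < \<epsilon>" "dist y x0 < \<epsilon>"
      using k(2) by auto
  qed
  define m where "m = f k + j * N k"
  have minimal: "m \<le> u (s, a) - \<phi> (s, b) + j * quartic_gauge (heis_mult (- a) b)"
    if "dist s t0 < r" "dist a x0 < r" "dist b x0 < r" for s a b
    using kmin[of "(s, a, b)"] that by (simp add: m_def K_def f_def N_def dist_commute)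
  have m_eq: "m = u (t, x) - \<phi> (t, y) + j * quartic_gauge (heis_mult (- x) y)"
    by (simp add: m_def f_def N_def k_eq)
  have tyQ: "(t, y) \<in> Q" using near \<epsilon> by (intro inQ) auto
  define d where "d = fst y - fst x"
  define w where "w = snd y - snd x - symp (fst x) (fst y)"
  have N_dw: "quartic_gauge (heis_mult (- x) y) = (d \<bullet> d)\<^sup>2 + w ^ 4"
    by (simp add: quartic_gauge_def heis_mult_uminus_eq d_def w_def)
  have \<phi>_le: "\<phi> z \<le> u z" if "z \<in> Q" for z
    using below[OF that] z0 by (cases "z = z0") auto
  note j\<phi> = C2H_imp_horiz_jet[OF \<phi>]
  have x_int: "dist t t0 < r" "dist x x0 < r" "dist y x0 < r" using near \<epsilon> by auto
  define h where "h = heis_mult y (- x)"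
  have hx: "heis_mult h x = y" and h1: "fst h = d"
    by (simp_all add: h_def heis_mult_eq symp_simps d_def prod_eq_iff)
  have hw: "snd h + 2 * symp d (fst x) = w"
    using symp_commute[of "fst x" "fst y"]
    by (simp add: h_def heis_mult_eq symp_simps d_def w_def)
  let ?H = "\<lambda>i k. horiz_deriv i (horiz_deriv k \<phi>) (t, y)"
  define R where "R = (\<chi> i k. 48 * j * w\<^sup>2 * symp d (axis i 1) * symp d (axis k 1))"
  define g where "g = (\<chi> k. horiz_deriv k \<phi> (t, y) - 8 * j * w ^ 3 * symp d (axis k 1))"
  have test1: "(g \<noteq> 0 \<longrightarrow> (p - 2) * (((sym_horiz_hess \<phi> (t, y) - R) *v g) \<bullet> g / (norm g)\<^sup>2)
        + (\<Sum>i\<in>UNIV. (sym_horiz_hess \<phi> (t, y) - R) $ i $ i) \<le> time_deriv \<phi> (t, y))"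
  proof -
    define U where "U = (ball t0 r \<times> ball x0 r) \<inter> (\<lambda>z. heis_mult h (snd z)) -` ball x0 r"
    have "open ((\<lambda>z :: real \<times> 'n heis. heis_mult h (snd z)) -` ball x0 r)"
      by (rule open_vimage) (intro open_ball continuous_intros)+
    then have oU: "open U" unfolding U_def by (intro open_Int open_Times open_ball)
    have zU: "(t, x) \<in> U" using x_int by (simp add: U_def hx dist_commute)
    have UQ: "U \<subseteq> Q" by (auto simp: U_def dist_commute intro!: inQ)
    have V: "\<forall>z\<in>U. (fst z, heis_mult h (snd z)) \<in> Q"
      by (auto simp: U_def dist_commute intro!: inQ)
    define \<psi> where "\<psi> = (\<lambda>z. (\<phi> (fst z, heis_mult h (snd z))
        + (- j) * quartic_gauge (heis_mult (- snd z) (heis_mult h (snd z)))) + m)"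
    note J = horiz_jet_add[OF horiz_jet_add[OF horiz_jet_left_translate[OF j\<phi> V]
        horiz_jet_cmult[OF horiz_jet_gauge_translate, of _ "- j" h]] horiz_jet_const[of _ m], folded \<psi>_def]
    have "\<psi> (t, x) = u (t, x)" by (simp add: \<psi>_def hx m_eq)
    moreover have "\<psi> z \<le> u z" if "z \<in> U" for z
      using minimal[of "fst z" "snd z" "heis_mult h (snd z)"] that by (auto simp: \<psi>_def U_def dist_commute)
    moreover have "g $ i = (horiz_deriv i \<phi> (fst (t, x), heis_mult h (snd (t, x)))
        + (- j) * (8 * (snd h + 2 * symp (fst h) (fst (snd (t, x)))) ^ 3 * symp (fst h) (axis i 1))) + 0" for i
      by (simp add: g_def hx h1 hw mult.assoc)
    ultimately show ?thesis
      using weak_supersol_local_test[OF Q u(1) \<phi> \<phi>_le oU zU UQ J, where g = g and S = "sym_horiz_hess \<phi> (t, y) - R"]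
      by (simp add: hx h1 hw sym_horiz_hess_def R_def field_simps)
  qed
  have R_le: "\<bar>R $ i $ k\<bar> \<le> e" for i k
  proof -
    have "\<bar>symp d (axis i 1) * symp d (axis k 1)\<bar> \<le> (2 * norm d) * (2 * norm d)"
      unfolding abs_mult by (intro mult_mono abs_symp_axis_le) auto
    also have "\<dots> = 4 * (d \<bullet> d)" by (simp add: power2_norm_eq_inner[symmetric] power2_eq_square)
    finally have "48 * j * w\<^sup>2 * \<bar>symp d (axis i 1) * symp d (axis k 1)\<bar> \<le> 48 * j * w\<^sup>2 * (4 * (d \<bullet> d))"
      using j by (intro mult_left_mono) auto
    then have "\<bar>R $ i $ k\<bar> \<le> 48 * j * w\<^sup>2 * (4 * (d \<bullet> d))"
      using j by (simp add: R_def abs_mult mult.assoc)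
    also have "\<dots> = 96 * j * (2 * (w\<^sup>2 * (d \<bullet> d)))" by simp
    also have "\<dots> \<le> 96 * j * ((d \<bullet> d)\<^sup>2 + w ^ 4)"
    proof (rule mult_left_mono)
      have "0 \<le> (w\<^sup>2 - d \<bullet> d)\<^sup>2" by simp
      then show "2 * (w\<^sup>2 * (d \<bullet> d)) \<le> (d \<bullet> d)\<^sup>2 + w ^ 4"
        by (simp add: power2_eq_square power4_eq_xxxx algebra_simps)
    qed (use j in simp)
    also have "\<dots> \<le> 96 * \<epsilon>" using jN by (simp add: N_def k_eq N_dw)
    finally show ?thesis using \<epsilon> by linarith
  qed
  show ?thesis
  proof (cases "g = 0")
    case False
    with test1 show ?thesis
      using near \<epsilon> e by (intro that[of "(t, y)" R] tyQ R_le disjI1 exI[of _ g]) (auto simp: \<epsilon>_def)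
  next
    case True
    have horiz1: "has_horiz_deriv i \<phi> (horiz_deriv i \<phi> z) z"
      and horiz2: "has_horiz_deriv i (horiz_deriv l \<phi>) (horiz_deriv i (horiz_deriv l \<phi>) z) z" if "z \<in> Q" for i l z
      using j\<phi> that unfolding horiz_jet_def by blast+
    \<comment> \<open>\<open>\<phi> - j N\<close> along the horizontal line through \<open>y\<close>, with \<open>t\<close> and \<open>x\<close> fixed.\<close>
    define B where "B = (\<lambda>i s. \<phi> (horiz_curve i (t, y) s)
      - j * (((d + s *\<^sub>R axis i 1) \<bullet> (d + s *\<^sub>R axis i 1))\<^sup>2 + (w + s * symp d (axis i 1)) ^ 4))"
    have B_max: "\<forall>\<^sub>F s in nhds 0. B i s \<le> B i 0" for i
    proof -
      have "\<forall>\<^sub>F s in nhds 0. horiz_curve i (t, y) s \<in> ball t0 r \<times> ball x0 r"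
        using x_int by (intro eventually_horiz_curve open_Times open_ball) (auto simp: dist_commute)
      then show ?thesis
      proof eventually_elim
        case (elim s)
        have "quartic_gauge (heis_mult (- x) (y + s *\<^sub>R horiz_field i y))
          = ((d + s *\<^sub>R axis i 1) \<bullet> (d + s *\<^sub>R axis i 1))\<^sup>2 + (w + s * symp d (axis i 1)) ^ 4"
          by (simp add: quartic_gauge_def heis_mult_uminus_eq horiz_field_eq d_def w_def symp_simps algebra_simps)
        then show ?case
          using minimal[of t x "y + s *\<^sub>R horiz_field i y"] x_int elim
          by (simp add: B_def m_eq N_dw dist_commute)
      qed
    qed
    have grad: "horiz_deriv i \<phi> (t, y) = j * (4 * (d \<bullet> d) * d $ i + 4 * w ^ 3 * symp d (axis i 1))" for i
    proof -
      have "(B i has_field_derivative horiz_deriv i \<phi> (t, y)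
          - j * (4 * (d \<bullet> d) * d $ i + 4 * w ^ 3 * symp d (axis i 1))) (at 0)"
        unfolding B_def inner_add_axis using horiz1[OF tyQ, of i] unfolding has_horiz_deriv_def
        by (auto intro!: derivative_eq_intros)
      moreover obtain \<delta> where "0 < \<delta>" "\<And>s. dist s 0 < \<delta> \<Longrightarrow> B i s \<le> B i 0"
        using B_max[of i] by (auto simp: eventually_nhds_metric)
      ultimately have "horiz_deriv i \<phi> (t, y) - j * (4 * (d \<bullet> d) * d $ i + 4 * w ^ 3 * symp d (axis i 1)) = 0"
        by (intro DERIV_local_max[of "B i" _ 0 \<delta>]) auto
      then show ?thesis by simp
    qed
    have "(d \<bullet> d) * d $ i = w ^ 3 * symp d (axis i 1)" for i
    proof -
      have "horiz_deriv i \<phi> (t, y) = 8 * j * w ^ 3 * symp d (axis i 1)"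
        using True by (simp add: g_def vec_eq_iff)
      then have "4 * j * ((d \<bullet> d) * d $ i) = 4 * j * (w ^ 3 * symp d (axis i 1))"
        using grad[of i] by (simp add: algebra_simps)
      then show ?thesis using j by simp
    qed
    then have "(\<Sum>i\<in>UNIV. (d \<bullet> d) * d $ i * d $ i) = (\<Sum>i\<in>UNIV. w ^ 3 * (d $ i * symp d (axis i 1)))"
      by (intro sum.cong) (auto simp: algebra_simps)
    then have "(d \<bullet> d) * (d \<bullet> d) = w ^ 3 * symp d d"
      by (simp add: sum_distrib_left[symmetric] sum_symp_axis mult.assoc inner_vec_def)
    then have d0: "d = 0" by simp
    have "0 \<le> time_deriv \<phi> (t, y)"
    proof -
      define U where "U = ball t0 r \<times> ball x0 r"
      have oU: "open U" unfolding U_def by (intro open_Times open_ball)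
      have zU: "(t, x) \<in> U" using x_int by (simp add: U_def dist_commute)
      have UQ: "U \<subseteq> Q" by (auto simp: U_def dist_commute intro!: inQ)
      have V: "\<forall>z\<in>U. (fst z, y) \<in> Q"
        using x_int by (auto simp: U_def dist_commute intro!: inQ)
      define \<psi> where "\<psi> = (\<lambda>z. (\<phi> (fst z, y) + (- j) * quartic_gauge (heis_mult (- snd z) y)) + m)"
      note J = horiz_jet_add[OF horiz_jet_add[OF horiz_jet_freeze_space[OF j\<phi> V]
          horiz_jet_cmult[OF horiz_jet_gauge_left, of _ "- j" y]] horiz_jet_const[of _ m], folded \<psi>_def]
      have "\<psi> (t, x) = u (t, x)" by (simp add: \<psi>_def m_eq)
      moreover have "\<psi> z \<le> u z" if "z \<in> U" for z
        using minimal[of "fst z" "snd z" y] that x_int by (auto simp: \<psi>_def U_def dist_commute)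
      moreover have "j * (4 * v ^ 3 * symp (axis i 1) (axis l 1)) + j * (4 * v ^ 3 * symp (axis l 1) (axis i 1)) = 0"
        for v and i l :: "'n + 'n"
        using symp_commute[of "axis i 1" "axis l 1"] by simp
      moreover have "fst y = fst x" using d0 by (simp add: d_def)
      ultimately show ?thesis
        using weak_supersol_local_test[OF Q u(1) \<phi> \<phi>_le oU zU UQ J, where g = 0 and S = 0]
        by (simp add: symp_simps)
    qed
    moreover have "horiz_deriv i (horiz_deriv i \<phi>) (t, y) \<le> 0" for i
    proof (rule second_deriv_nonpos_at_local_max[OF _ _ B_max[of i]])
      let ?B' = "\<lambda>s. horiz_deriv i \<phi> (horiz_curve i (t, y) s) - 4 * j * s ^ 3"
      have "\<forall>\<^sub>F s in nhds 0. horiz_curve i (t, y) s \<in> Q"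
        by (rule eventually_horiz_curve[OF Q tyQ])
      then show "\<forall>\<^sub>F s in nhds 0. (B i has_field_derivative ?B' s) (at s)"
      proof eventually_elim
        case (elim s)
        show ?case
          unfolding B_def inner_add_axis d0
          using has_horiz_deriv_along_curve[OF horiz1[OF elim, of i]]
          by (auto intro!: derivative_eq_intros simp: symp_simps power2_eq_square power3_eq_cube)
      qed
      show "(?B' has_field_derivative horiz_deriv i (horiz_deriv i \<phi>) (t, y)) (at 0)"
        using horiz2[OF tyQ, of i i] unfolding has_horiz_deriv_def
        by (auto intro!: derivative_eq_intros)
    qed
    ultimately show ?thesis
      using near \<epsilon> e by (intro that[of "(t, y)" 0] tyQ disjI2) (auto simp: \<epsilon>_def)
  qed
qed


lemma quadratic_form_close:
  fixes A B :: "real ^ 'm::finite ^ 'm"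
  assumes "\<And>i j. \<bar>A $ i $ j - B $ i $ j\<bar> \<le> c"
  shows "\<bar>(A *v g) \<bullet> g - (B *v g) \<bullet> g\<bar> \<le> c * (real CARD('m))\<^sup>2 * (norm g)\<^sup>2"
proof -
  have c: "0 \<le> c" using assms[of undefined undefined] by linarith
  have "(A *v g) \<bullet> g - (B *v g) \<bullet> g = ((A - B) *v g) \<bullet> g"
    by (simp add: matrix_vector_mult_diff_rdistrib inner_diff_left)
  also have "\<dots> = (\<Sum>i\<in>UNIV. \<Sum>j\<in>UNIV. (A $ i $ j - B $ i $ j) * g $ j * g $ i)"
    by (simp add: inner_vec_def matrix_vector_mult_def sum_distrib_right)
  finally have "\<bar>(A *v g) \<bullet> g - (B *v g) \<bullet> g\<bar>
      \<le> (\<Sum>i\<in>UNIV. \<Sum>j\<in>UNIV. \<bar>(A $ i $ j - B $ i $ j) * g $ j * g $ i\<bar>)"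
    by (simp only:) (intro order_trans[OF sum_abs] sum_mono sum_abs)
  also have "\<dots> \<le> (\<Sum>i\<in>(UNIV::'m set). \<Sum>j\<in>(UNIV::'m set). c * norm g * norm g)"
    unfolding abs_mult using c by (intro sum_mono mult_mono assms component_le_norm_cart) auto
  also have "\<dots> = c * (real CARD('m))\<^sup>2 * (norm g)\<^sup>2"
    by (simp add: power2_eq_square)
  finally show ?thesis .
qed

lemma C2H_second_order_close:
  assumes "C2H Q \<phi>" "z0 \<in> Q" "0 < e"
  obtains \<delta> where "0 < \<delta>" "\<And>z. z \<in> Q \<Longrightarrow> dist z z0 < \<delta> \<Longrightarrow> \<bar>time_deriv \<phi> z - time_deriv \<phi> z0\<bar> < e"
    "\<And>z i j. z \<in> Q \<Longrightarrow> dist z z0 < \<delta> \<Longrightarrow>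
       \<bar>horiz_deriv i (horiz_deriv j \<phi>) z - horiz_deriv i (horiz_deriv j \<phi>) z0\<bar> < e"
proof -
  have ev: "\<forall>\<^sub>F z in at z0 within Q. \<bar>f z - f z0\<bar> < e" if "continuous_on Q f" for f :: "_ \<Rightarrow> real"
    using that assms(2,3) unfolding continuous_on_def by (auto dest!: bspec simp: tendsto_iff dist_real_def)
  have "\<forall>\<^sub>F z in at z0 within Q. \<bar>time_deriv \<phi> z - time_deriv \<phi> z0\<bar> < e \<and>
    (\<forall>i j. \<bar>horiz_deriv i (horiz_deriv j \<phi>) z - horiz_deriv i (horiz_deriv j \<phi>) z0\<bar> < e)"
    using assms(1) by (intro eventually_conj eventually_all_finite ev) (auto simp: C2H_def)
  then obtain \<delta> where \<delta>: "0 < \<delta>" "\<And>z. z \<in> Q \<Longrightarrow> z \<noteq> z0 \<Longrightarrow> dist z z0 < \<delta> \<Longrightarrow>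
     \<bar>time_deriv \<phi> z - time_deriv \<phi> z0\<bar> < e \<and>
    (\<forall>i j. \<bar>horiz_deriv i (horiz_deriv j \<phi>) z - horiz_deriv i (horiz_deriv j \<phi>) z0\<bar> < e)"
    unfolding eventually_at by blast
  show ?thesis
  proof (rule that[OF \<delta>(1)])
    fix z assume z: "z \<in> Q" "dist z z0 < \<delta>"
    show "\<bar>time_deriv \<phi> z - time_deriv \<phi> z0\<bar> < e"
      using \<delta>(2)[OF z(1) _ z(2)] assms(3) by (cases "z = z0") auto
    show "\<bar>horiz_deriv i (horiz_deriv j \<phi>) z - horiz_deriv i (horiz_deriv j \<phi>) z0\<bar> < e" for i j
      using \<delta>(2)[OF z(1) _ z(2)] assms(3) by (cases "z = z0") auto
  qed
qed

text \<open>
  Both cases of \<open>touching_alternative\<close> give the inequality up to an error proportional to \<open>e\<close>. In the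
  first one the direction of the gradient may vary with \<open>e\<close>, and \<open>\<lambda>\<^sub>m\<^sub>i\<^sub>n\<close> bounds the quadratic form
  from below in every direction. In the second one it suffices to use the direction of a single coordinate axis:
  \<open>\<lambda>\<^sub>m\<^sub>i\<^sub>n((p - 2) A) + tr A \<le> (p - 1) A\<^sub>k\<^sub>k + \<Sum> A\<^sub>i\<^sub>i\<close>, summed over \<open>i \<noteq> k\<close>, whose right-hand side is nonpositive up to the error,
  since \<open>p > 1\<close> and every diagonal entry is.
\<close>

lemma critical_point_inequality:
  fixes u :: "real \<times> 'n::finite heis \<Rightarrow> real"
  assumes p: "1 < p" and Q: "open Q" and u: "weak_supersol p Q u" "lsc_on Q u"
    and \<phi>: "C2H Q \<phi>" and z0: "z0 \<in> Q" "u z0 = \<phi> z0" and below: "\<And>z. z \<in> Q \<Longrightarrow> z \<noteq> z0 \<Longrightarrow> \<phi> z < u z"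
  shows "lambda_min ((p - 2) *\<^sub>R sym_horiz_hess \<phi> z0) + horiz_laplacian \<phi> z0 \<le> time_deriv \<phi> z0"
proof -
  define A where "A = sym_horiz_hess \<phi> z0"
  define lam where "lam = lambda_min ((p - 2) *\<^sub>R A)"
  define n where "n = real CARD('n + 'n)"
  \<comment> \<open>The errors from \<open>\<phi>\<^sub>t\<close>, the quadratic form, the trace, and the diagonal entries in the second case.\<close>
  define C where "C = 1 + \<bar>p - 2\<bar> * 2 * n\<^sup>2 + 2 * n + (p - 1)"
  have n: "0 \<le> n" by (simp add: n_def)
  have "0 \<le> \<bar>p - 2\<bar> * 2 * n\<^sup>2" by simp
  then have C: "0 < C" using p n unfolding C_def by linarith
  have "transpose ((p - 2) *\<^sub>R A) = (p - 2) *\<^sub>R A"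
    by (simp add: A_def sym_horiz_hess_def transpose_def vec_eq_iff add.commute)
  then have lam: "lam * (v \<bullet> v) \<le> (p - 2) * ((A *v v) \<bullet> v)" for v
    using lambda_min_le_Rayleigh[of "(p - 2) *\<^sub>R A" v]
    by (simp add: lam_def scaleR_matrix_vector_assoc[symmetric])
  have lap: "horiz_laplacian \<phi> z = (\<Sum>i\<in>UNIV. sym_horiz_hess \<phi> z $ i $ i)" for z
    by (simp add: horiz_laplacian_def sym_horiz_hess_def)
  have main: "lam + horiz_laplacian \<phi> z0 \<le> time_deriv \<phi> z0 + C * e" if e: "0 < e" for e
  proof -
    obtain \<delta> where \<delta>: "0 < \<delta>"
      "\<And>z. z \<in> Q \<Longrightarrow> dist z z0 < \<delta> \<Longrightarrow> \<bar>time_deriv \<phi> z - time_deriv \<phi> z0\<bar> < e"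
      "\<And>z i j. z \<in> Q \<Longrightarrow> dist z z0 < \<delta> \<Longrightarrow>
         \<bar>horiz_deriv i (horiz_deriv j \<phi>) z - horiz_deriv i (horiz_deriv j \<phi>) z0\<bar> < e"
      using C2H_second_order_close[OF \<phi> z0(1) e] by blast
    have "0 < min \<delta> e" using \<delta>(1) e by simp
    from touching_alternative[OF Q u \<phi> z0 below this]
    obtain z R where z: "z \<in> Q" "dist z z0 < min \<delta> e" and R: "\<And>i j. \<bar>R $ i $ j\<bar> \<le> min \<delta> e"
      and alt: "(\<exists>g. g \<noteq> 0 \<and> (p - 2) * (((sym_horiz_hess \<phi> z - R) *v g) \<bullet> g / (norm g)\<^sup>2)
        + (\<Sum>i\<in>UNIV. (sym_horiz_hess \<phi> z - R) $ i $ i) \<le> time_deriv \<phi> z)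
       \<or> 0 \<le> time_deriv \<phi> z \<and> (\<forall>k. horiz_deriv k (horiz_deriv k \<phi>) z \<le> 0)"
      by blast
    have \<tau>: "\<bar>time_deriv \<phi> z - time_deriv \<phi> z0\<bar> < e"
      and H: "\<bar>horiz_deriv i (horiz_deriv j \<phi>) z - horiz_deriv i (horiz_deriv j \<phi>) z0\<bar> < e" for i j
      using z \<delta>(2,3)[of z] by auto
    have pos: "0 \<le> \<bar>p - 2\<bar> * 2 * n\<^sup>2 * e" "0 \<le> n * e" "0 \<le> (p - 1) * e"
      using n e p by auto
    have C_expand: "C * e = e + \<bar>p - 2\<bar> * 2 * n\<^sup>2 * e + 2 * (n * e) + (p - 1) * e"
      by (simp add: C_def algebra_simps)
    from alt show ?thesis
    proof (elim disjE exE conjE)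
      fix g assume g: "g \<noteq> 0" and ineq: "(p - 2) * (((sym_horiz_hess \<phi> z - R) *v g) \<bullet> g / (norm g)\<^sup>2)
        + (\<Sum>i\<in>UNIV. (sym_horiz_hess \<phi> z - R) $ i $ i) \<le> time_deriv \<phi> z"
      define M where "M = sym_horiz_hess \<phi> z - R"
      have MA: "\<bar>M $ i $ j - A $ i $ j\<bar> \<le> 2 * e" for i j
        using H[of i j] H[of j i] R[of i j] by (simp add: M_def A_def sym_horiz_hess_def abs_le_iff field_simps) (smt (verit))
      have ng: "0 < (norm g)\<^sup>2" using g by simp
      have "\<bar>(M *v g) \<bullet> g - (A *v g) \<bullet> g\<bar> \<le> (2 * e) * n\<^sup>2 * (norm g)\<^sup>2"
        unfolding n_def by (rule quadratic_form_close[OF MA])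
      then have "\<bar>(p - 2) * ((M *v g) \<bullet> g - (A *v g) \<bullet> g)\<bar> \<le> \<bar>p - 2\<bar> * ((2 * e) * n\<^sup>2 * (norm g)\<^sup>2)"
        unfolding abs_mult by (intro mult_left_mono) auto
      then have "lam * (norm g)\<^sup>2 \<le> (p - 2) * ((M *v g) \<bullet> g) + \<bar>p - 2\<bar> * 2 * n\<^sup>2 * e * (norm g)\<^sup>2"
        using lam[of g] by (simp add: power2_norm_eq_inner abs_le_iff algebra_simps)
      then have "lam \<le> (p - 2) * ((M *v g) \<bullet> g / (norm g)\<^sup>2) + \<bar>p - 2\<bar> * 2 * n\<^sup>2 * e"
        using ng by (simp add: field_simps)
      moreover have "horiz_laplacian \<phi> z0 \<le> (\<Sum>i\<in>UNIV. M $ i $ i) + 2 * (n * e)"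
      proof -
        have "horiz_laplacian \<phi> z0 \<le> (\<Sum>i\<in>(UNIV :: ('n + 'n) set). M $ i $ i + 2 * e)"
          unfolding lap A_def[symmetric] by (intro sum_mono) (use MA in \<open>simp add: abs_le_iff algebra_simps\<close>)
        then show ?thesis by (simp add: sum.distrib n_def)
      qed
      ultimately show ?thesis
        using ineq \<tau> pos unfolding M_def[symmetric] C_expand by linarith
    next
      assume "0 \<le> time_deriv \<phi> z" and neg: "\<forall>k. horiz_deriv k (horiz_deriv k \<phi>) z \<le> 0"
      have A_le: "A $ i $ i \<le> e" for i
        using H[of i i] neg[rule_format, of i] by (simp add: A_def sym_horiz_hess_def)
      \<comment> \<open>Any coordinate direction will do.\<close>
      obtain k :: "'n + 'n" where True by blast
      have "(A *v axis k 1) \<bullet> axis k 1 = A $ k $ k"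
        by (simp add: inner_axis matrix_vector_mult_basis column_def)
      then have "lam \<le> (p - 2) * A $ k $ k"
        using lam[of "axis k 1"] by (simp add: inner_axis_axis)
      moreover have "horiz_laplacian \<phi> z0 = A $ k $ k + (\<Sum>i\<in>UNIV - {k}. A $ i $ i)"
        unfolding lap A_def[symmetric] by (simp add: sum.remove[of UNIV k])
      moreover have "(\<Sum>i\<in>UNIV - {k}. A $ i $ i) \<le> n * e"
      proof -
        have "(\<Sum>i\<in>UNIV - {k}. A $ i $ i) \<le> (\<Sum>i\<in>UNIV - {k}. e)" by (intro sum_mono A_le)
        also have "\<dots> \<le> (\<Sum>i\<in>(UNIV :: ('n + 'n) set). e)" using e by (intro sum_mono2) auto
        finally show ?thesis by (simp add: n_def)
      qed
      moreover have "(p - 2) * A $ k $ k + A $ k $ k \<le> (p - 1) * e"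
        using mult_left_mono[OF A_le[of k], of "p - 1"] p by (simp add: algebra_simps)
      ultimately show ?thesis
        using \<open>0 \<le> time_deriv \<phi> z\<close> \<tau> pos unfolding C_expand by linarith
    qed
  qed
  have "lam + horiz_laplacian \<phi> z0 \<le> time_deriv \<phi> z0"
  proof (rule field_le_epsilon)
    fix e :: real assume "0 < e"
    then show "lam + horiz_laplacian \<phi> z0 \<le> time_deriv \<phi> z0 + e"
      using main[of "e / C"] C by simp
  qed
  then show ?thesis by (simp add: lam_def A_def)
qed

lemma weak_supersol_imp_visc_supersol:
  fixes u :: "real \<times> 'n::finite heis \<Rightarrow> real"
  assumes p: "1 < p" and Q: "open Q" and u: "weak_supersol p Q u" "lsc_on Q u"
  shows "visc_supersol p Q (\<lambda>z. ereal (u z))"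
  unfolding visc_supersol_def
proof (intro conjI ballI allI impI)
  show "lsc_on Q (\<lambda>z. ereal (u z))"
    unfolding lsc_on_def
  proof (intro ballI allI impI)
    fix z c assume "z \<in> Q" "c < ereal (u z)"
    then show "\<forall>\<^sub>F w in at z within Q. c < ereal (u w)"
      using u(2) by (cases c) (auto simp: lsc_on_def)
  qed
  show "\<exists>z\<in>C. ereal (u z) \<noteq> \<infinity>" if "C \<in> components Q" for C
    using in_components_nonempty[OF that] by auto
next
  fix z0 \<phi> assume "z0 \<in> Q" and *: "C2H Q \<phi> \<and> ereal (u z0) = ereal (\<phi> z0) \<and>
      (\<forall>z\<in>Q. z \<noteq> z0 \<longrightarrow> ereal (\<phi> z) < ereal (u z))"
  {
    assume "horiz_grad \<phi> z0 \<noteq> 0"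
    then show "(p - 2) * horiz_inf_laplacian \<phi> z0 + horiz_laplacian \<phi> z0 \<le> time_deriv \<phi> z0"
      using u(1) \<open>z0 \<in> Q\<close> * unfolding weak_supersol_def by auto
  }
  show "lambda_min ((p - 2) *\<^sub>R sym_horiz_hess \<phi> z0) + horiz_laplacian \<phi> z0 \<le> time_deriv \<phi> z0"
    using * by (intro critical_point_inequality[OF p Q u _ \<open>z0 \<in> Q\<close>]) auto
qed simp

section \<open>Subsolutions by reflection\<close>

lemma horiz_derivs_uminus:
  assumes "open Q" "C2H Q \<phi>"
  shows "C2H Q (\<lambda>z. - \<phi> z)"
    and "z \<in> Q \<Longrightarrow> horiz_deriv i (\<lambda>z. - \<phi> z) z = - horiz_deriv i \<phi> z"
    and "z \<in> Q \<Longrightarrow> horiz_deriv i (horiz_deriv j (\<lambda>z. - \<phi> z)) z = - horiz_deriv i (horiz_deriv j \<phi>) z"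
    and "z \<in> Q \<Longrightarrow> time_deriv (\<lambda>z. - \<phi> z) z = - time_deriv \<phi> z"
proof -
  have J: "horiz_jet Q (\<lambda>z. - \<phi> z) (\<lambda>i z. - horiz_deriv i \<phi> z)
      (\<lambda>i j z. - horiz_deriv i (horiz_deriv j \<phi>) z) (\<lambda>z. - time_deriv \<phi> z)"
    using horiz_jet_cmult[OF C2H_imp_horiz_jet[OF assms(2)], of "- 1"] by simp
  show "C2H Q (\<lambda>z. - \<phi> z)" by (rule horiz_jet_imp_C2H[OF assms(1) J])
  show "z \<in> Q \<Longrightarrow> horiz_deriv i (\<lambda>z. - \<phi> z) z = - horiz_deriv i \<phi> z"
    "z \<in> Q \<Longrightarrow> horiz_deriv i (horiz_deriv j (\<lambda>z. - \<phi> z)) z = - horiz_deriv i (horiz_deriv j \<phi>) z"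
    "z \<in> Q \<Longrightarrow> time_deriv (\<lambda>z. - \<phi> z) z = - time_deriv \<phi> z"
    using horiz_jet_derivs[OF assms(1) J] by auto
qed

lemma weak_supersol_uminus:
  assumes Q: "open Q"
    and above: "\<And>z0 \<phi>. z0 \<in> Q \<Longrightarrow> C2H Q \<phi> \<Longrightarrow> u z0 = \<phi> z0 \<Longrightarrow> (\<And>z. z \<in> Q \<Longrightarrow> z \<noteq> z0 \<Longrightarrow> u z < \<phi> z) \<Longrightarrow>
       (horiz_grad \<phi> z0 \<noteq> 0 \<longrightarrow>
          time_deriv \<phi> z0 \<le> (p - 2) * horiz_inf_laplacian \<phi> z0 + horiz_laplacian \<phi> z0) \<and>
       (horiz_grad \<phi> z0 = 0 \<and> sym_horiz_hess \<phi> z0 = 0 \<longrightarrow> time_deriv \<phi> z0 \<le> 0)"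
  shows "weak_supersol p Q (\<lambda>z. - u z)"
  unfolding weak_supersol_def
proof (intro ballI allI impI)
  fix z0 \<phi>
  assume z0: "z0 \<in> Q" and *: "C2H Q \<phi> \<and> - u z0 = \<phi> z0 \<and> (\<forall>z\<in>Q. z \<noteq> z0 \<longrightarrow> \<phi> z < - u z)"
  note D = horiz_derivs_uminus[OF Q conjunct1[OF *]]
  have grad: "horiz_grad (\<lambda>z. - \<phi> z) z0 = - horiz_grad \<phi> z0"
    using D(2)[OF z0] by (simp add: horiz_grad_def vec_eq_iff)
  have hess: "sym_horiz_hess (\<lambda>z. - \<phi> z) z0 = - sym_horiz_hess \<phi> z0"
    using D(3)[OF z0] by (simp add: sym_horiz_hess_def vec_eq_iff field_simps)
  have lap: "horiz_laplacian (\<lambda>z. - \<phi> z) z0 = - horiz_laplacian \<phi> z0"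
    using D(3)[OF z0] by (simp add: horiz_laplacian_def sum_negf)
  have inf: "horiz_inf_laplacian (\<lambda>z. - \<phi> z) z0 = - horiz_inf_laplacian \<phi> z0"
    unfolding horiz_inf_laplacian_def grad hess
    by (simp add: matrix_vector_mult_def inner_vec_def sum_negf)
  have "(horiz_grad (\<lambda>z. - \<phi> z) z0 \<noteq> 0 \<longrightarrow>
          time_deriv (\<lambda>z. - \<phi> z) z0 \<le> (p - 2) * horiz_inf_laplacian (\<lambda>z. - \<phi> z) z0 + horiz_laplacian (\<lambda>z. - \<phi> z) z0) \<and>
       (horiz_grad (\<lambda>z. - \<phi> z) z0 = 0 \<and> sym_horiz_hess (\<lambda>z. - \<phi> z) z0 = 0 \<longrightarrow> time_deriv (\<lambda>z. - \<phi> z) z0 \<le> 0)"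
    using * D(1) by (intro above z0) force+
  then show "(horiz_grad \<phi> z0 \<noteq> 0 \<longrightarrow>
          (p - 2) * horiz_inf_laplacian \<phi> z0 + horiz_laplacian \<phi> z0 \<le> time_deriv \<phi> z0) \<and>
       (horiz_grad \<phi> z0 = 0 \<and> sym_horiz_hess \<phi> z0 = 0 \<longrightarrow> 0 \<le> time_deriv \<phi> z0)"
    unfolding grad hess lap inf D(4)[OF z0] by (auto simp: algebra_simps)
qed

theorem theorem1p3:
  fixes p T :: real and \<Omega> :: "'n::finite heis set" and Q :: "(real \<times> 'n heis) set"
  assumes "1 < p" and "open \<Omega>" and "0 < T"
    and "Q = {0<..<T} \<times> \<Omega>"
  shows
    "(\<forall>u :: real \<times> 'n heis \<Rightarrow> real.
        lsc_on Q u \<and>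
        (\<forall>z0\<in>Q. \<forall>\<phi>.
           C2H Q \<phi> \<and> u z0 = \<phi> z0 \<and> (\<forall>z\<in>Q. z \<noteq> z0 \<longrightarrow> u z > \<phi> z) \<longrightarrow>
           (horiz_grad \<phi> z0 \<noteq> 0 \<longrightarrow>
              time_deriv \<phi> z0 \<ge> (p - 2) * horiz_inf_laplacian \<phi> z0 + horiz_laplacian \<phi> z0) \<and>
           (horiz_grad \<phi> z0 = 0 \<and> sym_horiz_hess \<phi> z0 = 0 \<longrightarrow> time_deriv \<phi> z0 \<ge> 0))
        \<longrightarrow> visc_supersol p Q (\<lambda>z. ereal (u z))) \<and>
     (\<forall>u :: real \<times> 'n heis \<Rightarrow> real.
        usc_on Q u \<and>
        (\<forall>z0\<in>Q. \<forall>\<phi>.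
           C2H Q \<phi> \<and> u z0 = \<phi> z0 \<and> (\<forall>z\<in>Q. z \<noteq> z0 \<longrightarrow> u z < \<phi> z) \<longrightarrow>
           (horiz_grad \<phi> z0 \<noteq> 0 \<longrightarrow>
              time_deriv \<phi> z0 \<le> (p - 2) * horiz_inf_laplacian \<phi> z0 + horiz_laplacian \<phi> z0) \<and>
           (horiz_grad \<phi> z0 = 0 \<and> sym_horiz_hess \<phi> z0 = 0 \<longrightarrow> time_deriv \<phi> z0 \<le> 0))
        \<longrightarrow> visc_subsol p Q (\<lambda>z. ereal (u z)))"
proof -
  have Q: "open Q" using assms(2,4) by (simp add: open_Times)
  show ?thesis
  proof (intro conjI allI impI; elim conjE)
    fix u :: "real \<times> 'n heis \<Rightarrow> real"
    assume u: "lsc_on Q u"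
    assume "\<forall>z0\<in>Q. \<forall>\<phi>.
           C2H Q \<phi> \<and> u z0 = \<phi> z0 \<and> (\<forall>z\<in>Q. z \<noteq> z0 \<longrightarrow> u z > \<phi> z) \<longrightarrow>
           (horiz_grad \<phi> z0 \<noteq> 0 \<longrightarrow>
              time_deriv \<phi> z0 \<ge> (p - 2) * horiz_inf_laplacian \<phi> z0 + horiz_laplacian \<phi> z0) \<and>
           (horiz_grad \<phi> z0 = 0 \<and> sym_horiz_hess \<phi> z0 = 0 \<longrightarrow> time_deriv \<phi> z0 \<ge> 0)"
    then have "weak_supersol p Q u" unfolding weak_supersol_def .
    then show "visc_supersol p Q (\<lambda>z. ereal (u z))"
      by (rule weak_supersol_imp_visc_supersol[OF assms(1) Q _ u])
  next
    fix u :: "real \<times> 'n heis \<Rightarrow> real"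
    assume u: "usc_on Q u"
    assume above: "\<forall>z0\<in>Q. \<forall>\<phi>.
           C2H Q \<phi> \<and> u z0 = \<phi> z0 \<and> (\<forall>z\<in>Q. z \<noteq> z0 \<longrightarrow> u z < \<phi> z) \<longrightarrow>
           (horiz_grad \<phi> z0 \<noteq> 0 \<longrightarrow>
              time_deriv \<phi> z0 \<le> (p - 2) * horiz_inf_laplacian \<phi> z0 + horiz_laplacian \<phi> z0) \<and>
           (horiz_grad \<phi> z0 = 0 \<and> sym_horiz_hess \<phi> z0 = 0 \<longrightarrow> time_deriv \<phi> z0 \<le> 0)"
    have "lsc_on Q (\<lambda>z. - u z)"
      unfolding lsc_on_def
    proof (intro ballI allI impI)
      fix z c assume "z \<in> Q" "c < - u z"
      then have "\<forall>\<^sub>F w in at z within Q. u w < - c"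
        using u unfolding usc_on_def by (simp add: less_minus_iff[of "u z"])
      then show "\<forall>\<^sub>F w in at z within Q. c < - u w"
        by eventually_elim simp
    qed
    moreover have "weak_supersol p Q (\<lambda>z. - u z)"
      by (rule weak_supersol_uminus[OF Q]) (use above in blast)
    ultimately have "visc_supersol p Q (\<lambda>z. ereal (- u z))"
      by (intro weak_supersol_imp_visc_supersol[OF assms(1) Q])
    then show "visc_subsol p Q (\<lambda>z. ereal (u z))"
      by (simp add: visc_subsol_def)
  qed
qed

end
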